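(* Let $0<q<1$ and $a>0$, and let $\lfloor a\rfloor$ and $\{a\}$ denote the integer and fractional parts of $a$. With the operators $\mathcal{K}_{a,c}$ and the Askey--Wilson operator $\mathcal{D}_q$ defined in the context, $$\mathcal{D}_q^{\lfloor a\rfloor+1}\,\mathcal{K}_{1-\{a\},\,cq^{-a/2}}\,\mathcal{K}_{a,c}=I,$$ where $I$ is the identity map (acting on those $f\in C[-1,1]$ for which the left-hand side is defined).
   Context: Throughout $0<q<1$, $(A;q)_\infty=\prod_{k\ge0}(1-Aq^k)$, $(A_1,\dots,A_m;q)_\infty=\prod_j(A_j;q)_\infty$, and $$h(\cos\theta;a_1,\dots,a_n)=\prod_{j=1}^n(a_je^{i\theta},a_je^{-i\theta};q)_\infty .$$ The normalized continuous $q$-Hermite weight is $w_H(x|q)=\frac{(q,e^{2i\theta},e^{-2i\theta};q)_\infty}{2\pi\sqrt{1-x^2}}$, $x=\cos\theta$. The parameter $c$ is a nonzero complex number such that $h(\cos\phi;-1/c,-cq)$ has no zeros for $\phi\in[0,\pi]$ (i.e. $|c|\notin\{q^k:k\in\mathbb Z\}$); this is assumed for the second index of every operator appearing. Powers are principal. For $a>0$ and $f\in C[-1,1]$, $$(\mathcal{K}_{a,c}f)(\cos\theta)=q^{a(a-3)/4}\Big(\frac{1-q}{2c}\Big)^a h(\cos\theta;-cq^{1-a/2},-q^{a/2}/c)\int_0^\pi\frac{w_H(\cos\phi|q)\,(q^a;q)_\infty\, f(\cos\phi)\sin\phi\,d\phi}{h(\cos\phi;q^{a/2}e^{i\theta},q^{a/2}e^{-i\theta})\,h(\cos\phi;-1/c,-cq)}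 .$$ Askey--Wilson operator: write $x=(z+1/z)/2$ and $\breve f(z)=f(x)$; then $$(\mathcal{D}_qf)(x)=\frac{\breve f(q^{1/2}z)-\breve f(q^{-1/2}z)}{(q^{1/2}-q^{-1/2})(z-1/z)/2},\qquad x\in(-1,1),$$ which is defined on functions $f$ for which $\breve f$ extends analytically from the unit circle to the annulus $q^{1/2}<|z|<q^{-1/2}$ and continuously to its closure. *)

theory Defs
  imports "HOL-Complex_Analysis.Complex_Analysis"
begin

definition qpoch_inf :: "complex \<Rightarrow> real \<Rightarrow> complex" where
  "qpoch_inf A q = (\<Prod>k. 1 - A * of_real q ^ k)"

text \<open>\<open>h(cos \<theta>; a\<^sub>1, \<dots>, a\<^sub>n)\<close> as a function of \<open>x = cos \<theta> \<in> [-1,1]\<close>, where the choice \<open>\<theta> = arccos x\<close>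
  is immaterial: the defining product is invariant under \<open>\<theta> \<mapsto> -\<theta>\<close>.\<close>

definition qh :: "real \<Rightarrow> real \<Rightarrow> complex list \<Rightarrow> complex" where
  "qh q x as = (\<Prod>a\<leftarrow>as. qpoch_inf (a * cis (arccos x)) q * qpoch_inf (a * cis (- arccos x)) q)"

definition wH :: "real \<Rightarrow> real \<Rightarrow> complex" where
  "wH q x = qpoch_inf (of_real q) q * qpoch_inf (cis (2 * arccos x)) q
      * qpoch_inf (cis (- 2 * arccos x)) q / of_real (2 * pi * sqrt (1 - x\<^sup>2))"

definition admissible :: "real \<Rightarrow> complex \<Rightarrow> bool" where
  "admissible q c \<longleftrightarrow> c \<noteq> 0 \<and> (\<forall>\<phi>\<in>{0..pi}. qh q (cos \<phi>) [- 1 / c, - c * of_real q] \<noteq> 0)"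

text \<open>The operator \<open>\<K>\<^sub>a\<^sub>,\<^sub>c\<close>; only values at \<open>x \<in> [-1,1]\<close> are meaningful.\<close>

definition K_op :: "real \<Rightarrow> real \<Rightarrow> complex \<Rightarrow> (real \<Rightarrow> complex) \<Rightarrow> real \<Rightarrow> complex" where
  "K_op q a c f x =
     of_real (q powr (a * (a - 3) / 4)) * (of_real (1 - q) / (2 * c)) powr of_real a
     * qh q x [- c * of_real (q powr (1 - a / 2)), - of_real (q powr (a / 2)) / c]
     * integral {0..pi} (\<lambda>\<phi>.
         wH q (cos \<phi>) * qpoch_inf (of_real (q powr a)) q * f (cos \<phi>) * of_real (sin \<phi>)
         / (qh q (cos \<phi>) [of_real (q powr (a / 2)) * cis (arccos x),
                         of_real (q powr (a / 2)) * cis (- arccos x)]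
            * qh q (cos \<phi>) [- 1 / c, - c * of_real q]))"

text \<open>\<open>F\<close> is the extension of \<open>f\<close>, read on the unit circle via \<open>x = (z + 1/z)/2\<close>, to the closed annulus.
  Agreement is not required at \<open>z = 1\<close> and \<open>z = -1\<close>, because \<open>\<D>\<^sub>q f\<close> is defined on \<open>(-1,1)\<close> only and
  \<open>\<D>\<^sub>q\<close> has to be iterated; for \<open>f\<close> continuous on \<open>[-1,1]\<close> it holds there by continuity.
  By the identity theorem and continuity, \<open>F\<close> is unique on the closed annulus.\<close>

definition aw_extension :: "real \<Rightarrow> (real \<Rightarrow> complex) \<Rightarrow> (complex \<Rightarrow> complex) \<Rightarrow> bool" where
  "aw_extension q f F \<longleftrightarrow>
     F holomorphic_on {z. sqrt q < norm z \<and> norm z < 1 / sqrt q} \<and>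
     continuous_on {z. sqrt q \<le> norm z \<and> norm z \<le> 1 / sqrt q} F \<and>
     (\<forall>\<theta>. cos \<theta> \<in> {-1<..<1} \<longrightarrow> F (cis \<theta>) = f (cos \<theta>))"

definition aw_dom :: "real \<Rightarrow> (real \<Rightarrow> complex) set" where
  "aw_dom q = {f. \<exists>F. aw_extension q f F}"

text \<open>The Askey--Wilson operator \<open>\<D>\<^sub>q\<close>, meaningful for \<open>f \<in> aw_dom q\<close> and \<open>x \<in> (-1,1)\<close>. Replacing
  \<open>z = e\<^sup>i\<^sup>\<theta>\<close> by \<open>1/z\<close> changes the sign of both numerator and denominator.\<close>

definition aw_op :: "real \<Rightarrow> (real \<Rightarrow> complex) \<Rightarrow> real \<Rightarrow> complex" where
  "aw_op q f x =
     (let F = (SOME F. aw_extension q f F); z = cis (arccos x) in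
       (F (of_real (sqrt q) * z) - F (of_real (1 / sqrt q) * z))
       / (of_real (sqrt q - 1 / sqrt q) * (z - 1 / z) / 2))"

end

theory Submission
  imports Defs
begin

text \<open>The kernel of \<open>\<K>\<^sub>a\<^sub>,\<^sub>c\<close> is the Poisson kernel of the continuous \<open>q\<close>-Hermite polynomials with parameter
  \<open>t = q powr (a / 2)\<close>, conjugated by products of theta type. The semigroup law of the Poisson kernel is
  the Askey--Wilson integral with parameters \<open>s z, s/z, t u, t/u\<close>, and the conjugating factors of the two operators
  cancel; hence the two \<open>\<K>\<close> operators compose to \<open>\<K>\<^sub>n\<^sub>,\<^sub>c\<close> with \<open>n = \<lfloor>a\<rfloor> + 1\<close>. For \<open>n \<ge> 2\<close> a rational identity between kernels
  gives \<open>\<D>\<^sub>q \<K>\<^sub>n\<^sub>,\<^sub>c = \<K>\<^sub>n\<^sub>-\<^sub>1\<^sub>,\<^sub>c\<close>. For \<open>n = 1\<close> the same identity makes the difference of the two kernels vanish off the unit circle,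
  but they are evaluated on opposite sides of it, so \<open>\<D>\<^sub>q \<K>\<^sub>1\<^sub>,\<^sub>c f\<close> is the jump of a Cauchy integral, which is \<open>f\<close>.

  The Askey--Wilson integral is evaluated by Askey's method: a contour shift yields the effect of \<open>a \<mapsto> q a\<close> on the integral;
  iterating it in all four parameters reduces the integral to a constant, which is read off from the parameters
  \<open>\<surd>q, -\<surd>q, q, -q\<close>.\<close>

section \<open>The infinite \<open>q\<close>-shifted factorial\<close>

text \<open>The constants are forced. \<open>K_prefactor q c t\<close> depends only on
  \<open>c / t\<close>, so the factor in front of the first operator is the denominator of the
  second exactly when the second index is \<open>c / t\<close> with
  \<open>t = q powr (a / 2)\<close>. Raised to the power \<open>b\<close>, the rescaled base
  contributes \<open>t powr b = q powr (a * b / 2)\<close>, the cross term that turns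
  \<open>a * (a - 3) + b * (b - 3)\<close> into \<open>(a + b) * (a + b - 3)\<close>.

  The obstacle is the last \<open>q\<close>-difference. Each application divides \<open>t\<close> by
  \<open>\<surd>q\<close>, and at \<open>t = 1\<close> the kernel degenerates: its constant
  \<open>(t^2;q)_inf\<close> vanishes, and so does its denominator at the evaluation point. In
  addition, \<open>aw_op\<close> selects an extension by choice, and its boundary values are
  accessible only as limits of the explicit integral from inside the open annulus. Since
  \<open>f\<close> is merely continuous, the one-sided limits of a Cauchy integral could not be
  treated separately in general; the difference at the mirror points \<open>r z\<close> and
  \<open>z / r\<close> can, because its kernel is an approximate identity.\<close>

context
  fixes q :: real
  assumes q: "0 < q" "q < 1"
begin

lemma qpoch_convergent: "convergent_prod (\<lambda>k. 1 - A * complex_of_real q ^ k)"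
proof -
  have "summable (\<lambda>k. norm (- A * complex_of_real q ^ k))"
    using q by (auto simp: norm_mult norm_power intro!: summable_mult summable_geometric)
  then have "abs_convergent_prod (\<lambda>k. 1 + (- A * complex_of_real q ^ k))"
    by (simp add: abs_convergent_prod_conv_summable)
  then show ?thesis
    by (simp add: abs_convergent_prod_imp_convergent_prod)
qed

lemma qpoch_tendsto: "(\<lambda>n. \<Prod>k<n. 1 - A * complex_of_real q ^ k) \<longlonglongrightarrow> qpoch_inf A q"
  unfolding qpoch_inf_def
  using convergent_prod_LIMSEQ[OF qpoch_convergent] LIMSEQ_lessThan_iff_atMost by blast

lemma qpoch_step: "qpoch_inf A q = (1 - A) * qpoch_inf (A * of_real q) q"
proof (rule LIMSEQ_unique)
  show "(\<lambda>n. \<Prod>k<Suc n. 1 - A * complex_of_real q ^ k) \<longlonglongrightarrow> qpoch_inf A q"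
    using LIMSEQ_Suc[OF qpoch_tendsto] .
  have "(\<Prod>k<Suc n. 1 - A * complex_of_real q ^ k)
      = (1 - A) * (\<Prod>k<n. 1 - A * of_real q * complex_of_real q ^ k)" for n
    by (simp add: prod.lessThan_Suc_shift mult.assoc del: prod.lessThan_Suc)
  then show "(\<lambda>n. \<Prod>k<Suc n. 1 - A * complex_of_real q ^ k) \<longlonglongrightarrow> (1 - A) * qpoch_inf (A * of_real q) q"
    by (simp only:) (intro tendsto_intros qpoch_tendsto)
qed

lemma qpoch_0 [simp]: "qpoch_inf 0 q = 1"
  by (simp add: qpoch_inf_def)

lemma qpoch_1 [simp]: "qpoch_inf 1 q = 0"
  using qpoch_step[of 1] by simp

lemma qpoch_nonzero:
  assumes "norm A < 1"
  shows "qpoch_inf A q \<noteq> 0"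
  unfolding qpoch_inf_def
proof (rule prodinf_nonzero[OF qpoch_convergent])
  fix k
  have "norm (A * of_real q ^ k) < 1"
    using q assms power_le_one[of q k]
    by (simp add: norm_mult norm_power) (smt (verit) mult_left_le norm_ge_zero)
  then show "1 - A * complex_of_real q ^ k \<noteq> 0" by auto
qed

text \<open>The factors of index \<open>2n\<close> on the left split as
  \<open>(1 - A q^n)(1 + A q^n)\<close>, those of index \<open>2n + 1\<close> likewise with
  \<open>A * sqrt q\<close> for \<open>A\<close>; hence the comparison of partial products at even
  length.\<close>

lemma qpoch_square:
  "qpoch_inf (A\<^sup>2) q = qpoch_inf A q * qpoch_inf (- A) q
     * qpoch_inf (A * of_real (sqrt q)) q * qpoch_inf (- A * of_real (sqrt q)) q"
proof (rule LIMSEQ_unique)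
  have r: "complex_of_real q = of_real (sqrt q) ^ 2"
    using q by (simp flip: of_real_power)
  have "(\<Prod>k<2 * n. 1 - A\<^sup>2 * complex_of_real q ^ k)
      = (\<Prod>k<n. 1 - A * complex_of_real q ^ k) * (\<Prod>k<n. 1 - (- A) * complex_of_real q ^ k)
      * (\<Prod>k<n. 1 - A * of_real (sqrt q) * complex_of_real q ^ k)
      * (\<Prod>k<n. 1 - (- A * of_real (sqrt q)) * complex_of_real q ^ k)" (is "?L n = ?R n") for n
  proof (induction n)
    case (Suc n)
    have "?L (Suc n) = ?L n * (1 - A\<^sup>2 * complex_of_real q ^ (2*n)) * (1 - A\<^sup>2 * complex_of_real q ^ (2*n+1))"
      by simp
    also have "1 - A\<^sup>2 * complex_of_real q ^ (2*n)
        = (1 - A * complex_of_real q ^ n) * (1 - (- A) * complex_of_real q ^ n)"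
      by (simp add: algebra_simps power2_eq_square mult_2 mult_2_right power_add)
    also have "1 - A\<^sup>2 * complex_of_real q ^ (2*n+1)
        = (1 - A * of_real (sqrt q) * complex_of_real q ^ n) * (1 - (- A * of_real (sqrt q)) * complex_of_real q ^ n)"
      unfolding r by (simp add: algebra_simps power2_eq_square mult_2 mult_2_right power_add)
    finally show ?case unfolding Suc.IH by (simp add: ac_simps)
  qed auto
  moreover have "filterlim (\<lambda>n::nat. 2 * n) at_top at_top"
    by (rule filterlim_subseq) (auto simp: strict_mono_def)
  then have "(\<lambda>n. \<Prod>k<2 * n. 1 - A\<^sup>2 * complex_of_real q ^ k) \<longlonglongrightarrow> qpoch_inf (A\<^sup>2) q"
    using filterlim_compose[OF qpoch_tendsto] by blast
  ultimately show "?R \<longlonglongrightarrow> qpoch_inf (A\<^sup>2) q" by simp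
  show "?R \<longlonglongrightarrow> qpoch_inf A q * qpoch_inf (- A) q
     * qpoch_inf (A * of_real (sqrt q)) q * qpoch_inf (- A * of_real (sqrt q)) q"
    by (intro tendsto_intros qpoch_tendsto)
qed

lemma qpoch_holomorphic_UNIV: "(\<lambda>A. qpoch_inf A q) holomorphic_on UNIV"
proof (rule holomorphic_uniform_sequence)
  show "(\<lambda>A. \<Prod>k<n. 1 - A * complex_of_real q ^ k) holomorphic_on UNIV" for n
    by (intro holomorphic_intros)
  fix x :: complex
  have "uniformly_convergent_on (cball x 1) (\<lambda>N A. \<Prod>k<N. 1 + (- A * complex_of_real q ^ k))"
  proof (rule uniformly_convergent_on_prod)
    show "uniformly_convergent_on (cball x 1) (\<lambda>N A. \<Sum>n<N. norm (- A * complex_of_real q ^ n))"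
    proof (rule Weierstrass_m_test')
      show "norm (norm (- A * complex_of_real q ^ n)) \<le> (norm x + 1) * q ^ n" if "A \<in> cball x 1" for n A
      proof -
        have "norm A \<le> norm x + 1"
          using that norm_triangle_sub[of A x] by (simp add: dist_norm norm_minus_commute)
        then show ?thesis
          using q by (simp add: norm_mult norm_power mult_right_mono)
      qed
      show "summable (\<lambda>n. (norm x + 1) * q ^ n)"
        using q by (intro summable_mult summable_geometric) auto
    qed
  qed (auto intro!: continuous_intros)
  then obtain l where l: "uniform_limit (cball x 1) (\<lambda>N A. \<Prod>k<N. 1 - A * complex_of_real q ^ k) l sequentially"
    by (auto simp: uniformly_convergent_on_def)
  have "l A = qpoch_inf A q" if "A \<in> cball x 1" for A
    using LIMSEQ_unique[OF tendsto_uniform_limitI[OF l that] qpoch_tendsto] .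
  with l have "uniform_limit (cball x 1) (\<lambda>N A. \<Prod>k<N. 1 - A * complex_of_real q ^ k) (\<lambda>A. qpoch_inf A q) sequentially"
    using uniform_limit_cong' by (metis (no_types, lifting))
  then show "\<exists>d>0. cball x d \<subseteq> UNIV \<and>
      uniform_limit (cball x d) (\<lambda>N A. \<Prod>k<N. 1 - A * complex_of_real q ^ k) (\<lambda>A. qpoch_inf A q) sequentially"
    by (intro exI[of _ 1]) auto
qed auto

lemma qpoch_holomorphic [holomorphic_intros]:
  assumes "f holomorphic_on S"
  shows "(\<lambda>z. qpoch_inf (f z) q) holomorphic_on S"
  using holomorphic_on_compose_gen[OF assms qpoch_holomorphic_UNIV] by (simp add: o_def)

lemma qpoch_continuous [continuous_intros]:
  assumes "continuous_on S f"
  shows "continuous_on S (\<lambda>z. qpoch_inf (f z) q)"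
  using continuous_on_compose2[OF holomorphic_on_imp_continuous_on[OF qpoch_holomorphic_UNIV] assms] by simp

end

section \<open>The Askey--Wilson integral\<close>

text \<open>\<open>h(cos \<theta>; A)\<close> continued from \<open>z = cis \<theta>\<close> to
  complex \<open>z\<close>. For \<open>A \<noteq> 0\<close> its zeros are the points
  \<open>A q^k\<close> and \<open>1 / (A q^k)\<close>.\<close>

definition qth :: "real \<Rightarrow> complex \<Rightarrow> complex \<Rightarrow> complex" where
  "qth q A z = qpoch_inf (A * z) q * qpoch_inf (A / z) q"

definition aw_weight :: "real \<Rightarrow> complex \<Rightarrow> complex \<Rightarrow> complex \<Rightarrow> complex \<Rightarrow> complex \<Rightarrow> complex" where
  "aw_weight q a b c d z = qth q 1 (z\<^sup>2) / (qth q a z * qth q b z * qth q c z * qth q d z)"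

definition aw_integral :: "real \<Rightarrow> complex \<Rightarrow> complex \<Rightarrow> complex \<Rightarrow> complex \<Rightarrow> complex" where
  "aw_integral q a b c d = integral {-pi..pi} (\<lambda>t. aw_weight q a b c d (cis t))"

text \<open>Both sides are, up to the factor \<open>\<i>\<close>, contour integrals of
  \<open>F z / z\<close>, and the radial segments give a homotopy of the circles inside
  \<open>S\<close>. Angles run over \<open>{-pi..pi}\<close> so that inversion of the circle becomes
  the reflection \<open>t \<mapsto> - t\<close>.\<close>

lemma integral_circle_radius_change:
  assumes F: "F holomorphic_on S" and S: "open S" "0 \<notin> S" and rs: "0 < r" "0 < s"
    and seg: "\<And>u. norm u = 1 \<Longrightarrow> closed_segment (of_real r * u) (of_real s * u) \<subseteq> S"
  shows "integral {-pi..pi} (\<lambda>t. F (of_real r * cis t)) = integral {-pi..pi} (\<lambda>t. F (of_real s * cis t))"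
proof -
  have eq: "contour_integral (part_circlepath 0 r (-pi) pi) (\<lambda>z. F z / z)
      = \<i> * integral {-pi..pi} (\<lambda>t. F (of_real r * cis t))" if "0 < r" for r
  proof -
    have "contour_integral (part_circlepath 0 r (-pi) pi) (\<lambda>z. F z / z)
        = integral {-pi..pi} (\<lambda>t. \<i> * F (of_real r * cis t))"
      using that by (simp add: contour_integral_part_circlepath_eq mult.commute mult.left_commute)
    then show ?thesis by simp
  qed
  have loop: "homotopic_loops S (part_circlepath 0 r (-pi) pi) (part_circlepath 0 s (-pi) pi)"
  proof (rule homotopic_loops_linear)
    fix t :: real
    show "closed_segment (part_circlepath 0 r (-pi) pi t) (part_circlepath 0 s (-pi) pi t) \<subseteq> S"
      unfolding part_circlepath_def using seg[of "cis (linepath (-pi) pi t)"] by (simp add: cis_conv_exp)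
  qed (simp_all add: path_part_circlepath exp_minus)
  have "(\<lambda>z. F z / z) holomorphic_on S"
    using F S by (intro holomorphic_intros) auto
  from Cauchy_theorem_homotopic_loops[OF loop S(1) this] show ?thesis
    by (simp add: eq rs valid_path_part_circlepath)
qed

lemma integral_circle_inversion:
  fixes F :: "complex \<Rightarrow> complex"
  shows "integral {-pi..pi} (\<lambda>t. F (1 / cis t)) = integral {-pi..pi} (\<lambda>t. F (cis t))"
proof -
  have "(\<lambda>t. F (1 / cis t)) = (\<lambda>t. F (cis (- t)))"
    by (metis cis_inverse inverse_eq_divide)
  then show ?thesis
    using Henstock_Kurzweil_Integration.integral_reflect_real[where b = pi and a = "-pi" and f = "\<lambda>t. F (cis t)"] by simp
qed

lemma integral_circle_half:
  fixes F :: "complex \<Rightarrow> complex"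
  assumes "continuous_on (sphere 0 1) F" and inv: "\<And>z. F (1 / z) = F z"
  shows "integral {-pi..pi} (\<lambda>t. F (cis t)) = 2 * integral {0..pi} (\<lambda>t. F (cis t))"
proof -
  have "continuous_on {-pi..pi} (\<lambda>t. F (cis t))"
    by (rule continuous_on_compose2[OF assms(1)]) (auto intro!: continuous_intros)
  then have "(\<lambda>t. F (cis t)) integrable_on {-pi..pi}"
    by (simp add: integrable_continuous_interval)
  then have "integral {-pi..pi} (\<lambda>t. F (cis t)) = integral {-pi..-0} (\<lambda>t. F (cis t)) + integral {0..pi} (\<lambda>t. F (cis t))"
    by (simp add: Henstock_Kurzweil_Integration.integral_combine)
  also have "integral {-pi..-0} (\<lambda>t. F (cis t)) = integral {-pi..-0} (\<lambda>t. F (cis (- t)))"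
    by (metis inv cis_inverse inverse_eq_divide)
  also have "\<dots> = integral {0..pi} (\<lambda>t. F (cis t))"
    using Henstock_Kurzweil_Integration.integral_reflect_real[where b = pi and a = 0 and f = "\<lambda>t. F (cis t)"] by simp
  finally show ?thesis by simp
qed

lemma qth_inverse: "qth q A (1 / z) = qth q A z"
  by (simp add: qth_def mult.commute)

lemma aw_weight_inverse: "aw_weight q a b c d (1 / z) = aw_weight q a b c d z"
  by (simp add: aw_weight_def qth_inverse power_divide)

lemma norm_mult_less_1:
  fixes x y :: complex
  assumes "norm x < 1" "norm y < 1" shows "norm (x * y) < 1"
proof -
  have "norm x * norm y \<le> norm x" using assms by (simp add: mult_left_le)
  with assms show ?thesis by (simp add: norm_mult)
qed

context
  fixes q :: real
  assumes q: "0 < q" "q < 1"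
begin

lemma qth_nonzero:
  assumes "norm A < norm z" "norm (A * z) < 1"
  shows "qth q A z \<noteq> 0"
proof -
  have "norm (A / z) < 1"
    using assms by (cases "z = 0") (auto simp: norm_divide divide_simps)
  then show ?thesis using assms qpoch_nonzero[OF q] by (simp add: qth_def)
qed

lemma qth_nonzero_circle: "norm A < 1 \<Longrightarrow> norm z = 1 \<Longrightarrow> qth q A z \<noteq> 0"
  by (rule qth_nonzero) (simp_all add: norm_mult)

lemma qth_holomorphic [holomorphic_intros]:
  assumes "f holomorphic_on S" "g holomorphic_on S" "\<And>z. z \<in> S \<Longrightarrow> g z \<noteq> 0"
  shows "(\<lambda>z. qth q (f z) (g z)) holomorphic_on S"
  unfolding qth_def using assms by (intro holomorphic_intros q) auto

lemma qth_continuous [continuous_intros]: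
  assumes "continuous_on S f" "continuous_on S g" "\<And>z. z \<in> S \<Longrightarrow> g z \<noteq> 0"
  shows "continuous_on S (\<lambda>z. qth q (f z) (g z))"
  unfolding qth_def using assms by (intro continuous_intros q) auto

lemma qth_step:
  "qth q A z = (1 - A * z) * (1 - A / z) * qth q (A * of_real q) z"
proof -
  have "qpoch_inf (A * z) q = (1 - A * z) * qpoch_inf (A * of_real q * z) q"
    "qpoch_inf (A / z) q = (1 - A / z) * qpoch_inf (A * of_real q / z) q"
    by (subst qpoch_step[OF q], simp add: mult_ac)+
  then show ?thesis by (simp add: qth_def)
qed

text \<open>Scaling both the parameter and the point by \<open>\<surd>q\<close> multiplies
  \<open>A * z\<close> by \<open>q\<close> and keeps \<open>A / z\<close>, so a single factor is
  lost. This is why the contour shift starts from the parameters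
  \<open>\<surd>q a, ..., \<surd>q d\<close>.\<close>

lemma qth_shift:
  assumes "z \<noteq> 0"
  shows "(1 - A * z) * qth q (of_real (sqrt q) * A) (of_real (sqrt q) * z) = qth q A z"
proof -
  have s2: "complex_of_real (sqrt q) * of_real (sqrt q) = of_real q"
    using q by (simp flip: of_real_mult)
  have 1: "of_real (sqrt q) * A * (of_real (sqrt q) * z) = A * z * of_real q"
    unfolding s2[symmetric] by (simp only: mult_ac)
  have 2: "of_real (sqrt q) * A / (of_real (sqrt q) * z) = A / z"
    using q by simp
  show ?thesis
    unfolding qth_def 1 2 using qpoch_step[OF q, of "A * z"] by simp
qed

lemma aw_weight_continuous:
  assumes "norm a < 1" "norm b < 1" "norm c < 1" "norm d < 1"
  shows "continuous_on (sphere 0 1) (aw_weight q a b c d)"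
  unfolding aw_weight_def using assms
  by (intro continuous_intros) (auto simp: qth_nonzero_circle)

lemma aw_weight_integrable:
  assumes "norm a < 1" "norm b < 1" "norm c < 1" "norm d < 1"
  shows "(\<lambda>t. aw_weight q a b c d (cis t)) integrable_on {-pi..pi}"
    "(\<lambda>t. (cis t + 1 / cis t) * aw_weight q a b c d (cis t)) integrable_on {-pi..pi}"
  by (intro integrable_continuous_interval continuous_intros continuous_on_compose2[OF aw_weight_continuous[OF assms]];
      force simp: cis_neq_zero)+

text \<open>The total \<open>q\<close>-difference of the weight with parameters \<open>\<surd>q a, \<surd>q b, \<surd>q c, \<surd>q d\<close>, divided by \<open>z - 1/z\<close>,
  is the weight itself times its first orthogonal polynomial; moving the contour shows that it integrates to \<open>0\<close>.\<close>

lemma aw_integral_first_moment: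
  assumes abcd: "norm a < 1" "norm b < 1" "norm c < 1" "norm d < 1"
  shows "(1 - a*b*c*d) * integral {-pi..pi} (\<lambda>t. (cis t + 1 / cis t) * aw_weight q a b c d (cis t))
       = (a + b + c + d - (a*b*c + a*b*d + a*c*d + b*c*d)) * aw_integral q a b c d"
proof -
  define s where "s = complex_of_real (sqrt q)"
  have s2: "s * s = of_real q" using q by (simp add: s_def flip: of_real_mult)
  have s0: "s \<noteq> 0" using q by (simp add: s_def)
  have s1: "norm s < 1" using q by (simp add: s_def)
  \<comment> \<open>This is the weight with parameters \<open>s * a, ..., s * d\<close> divided by
    \<open>z - 1/z\<close>. One factor of \<open>(1 - z^2)(1 - 1/z^2) = - (z - 1/z)^2\<close> has
    been cancelled, so \<open>\<Psi>\<close> is holomorphic across \<open>1\<close> and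
    \<open>-1\<close>.\<close>
  define \<Psi> where "\<Psi> z = - (z - 1/z) * qth q (of_real q) (z\<^sup>2)
      / (qth q (s * a) z * qth q (s * b) z * qth q (s * c) z * qth q (s * d) z)" for z
  define T where "T A = {z. norm (s * A) < norm z} \<inter> {z. norm (s * A * z) < 1}" for A
  have T: "open (T A)" "0 \<notin> T A" "z \<in> T A \<Longrightarrow> qth q (s * A) z \<noteq> 0" for A z
    unfolding T_def
    by (intro open_Int open_Collect_less continuous_intros) (auto simp: qth_nonzero)
  define S where "S = T a \<inter> T b \<inter> T c \<inter> T d"
  have S: "open S" "0 \<notin> S" using T unfolding S_def by auto
  have seg: "closed_segment (of_real (sqrt q) * u) (of_real (1 / sqrt q) * u) \<subseteq> S" if u: "norm u = 1" for u
  proof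
    fix z assume "z \<in> closed_segment (of_real (sqrt q) * u) (of_real (1 / sqrt q) * u)"
    then obtain \<rho> where \<rho>: "z = of_real \<rho> * u" "\<rho> \<in> closed_segment (sqrt q) (1 / sqrt q)"
    proof -
      obtain t where t: "0 \<le> t" "t \<le> 1"
        "z = (1 - t) *\<^sub>R (of_real (sqrt q) * u) + t *\<^sub>R (of_real (1 / sqrt q) * u)"
        using \<open>z \<in> _\<close> by (auto simp: closed_segment_def)
      have "z = of_real ((1 - t) * sqrt q + t * (1 / sqrt q)) * u"
        unfolding t(3) by (simp add: scaleR_conv_of_real algebra_simps)
      with t(1,2) that show ?thesis by (force simp: closed_segment_def)
    qed
    have le: "sqrt q \<le> 1 / sqrt q"
      using q by (simp add: pos_le_divide_eq)
    with \<rho> have \<rho>': "sqrt q \<le> \<rho>" "\<rho> \<le> 1 / sqrt q" "\<rho> > 0"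
      using q by (auto simp: closed_segment_eq_real_ivl intro: less_le_trans[of 0 "sqrt q"])
    have "sqrt q * \<rho> \<le> 1" using \<rho>' q by (simp add: pos_le_divide_eq mult.commute)
    have "z \<in> T A" if "norm A < 1" for A
    proof -
      have "sqrt q * norm A < \<rho>"
        using \<rho>'(1) that q by (smt (verit) mult_less_cancel_left2 real_sqrt_gt_zero)
      moreover have "sqrt q * norm A * \<rho> < 1"
        using \<open>sqrt q * \<rho> \<le> 1\<close> that \<rho>'(3) q
        by (smt (verit) mult.assoc mult.commute mult_less_cancel_left2 mult_pos_pos real_sqrt_gt_zero)
      ultimately show ?thesis
        using \<rho>' u q by (simp add: T_def \<rho>(1) s_def norm_mult)
    qed
    with abcd show "z \<in> S" by (simp add: S_def)
  qed
  have "\<Psi> holomorphic_on S"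
    unfolding \<Psi>_def using S T
    by (intro holomorphic_intros) (auto simp: S_def)
  from integral_circle_radius_change[OF this S _ _ seg] q
  have "integral {-pi..pi} (\<lambda>t. \<Psi> (s * cis t)) = integral {-pi..pi} (\<lambda>t. \<Psi> (of_real (1 / sqrt q) * cis t))"
    by (simp add: s_def)
  \<comment> \<open>Inversion exchanges the circles of radius \<open>\<surd>q\<close> and
    \<open>1/\<surd>q\<close> and changes the sign of \<open>\<Psi>\<close>: the two integrals,
    equal by Cauchy's theorem, are also opposite.\<close>
  also have "\<dots> = integral {-pi..pi} (\<lambda>t. - \<Psi> (s * (1 / cis t)))"
  proof (rule integral_cong)
    fix t
    have "\<Psi> (1 / z) = - \<Psi> z" for z
    proof -
      have inv: "- (1 / z - 1 / (1 / z)) = z - 1 / z" by simp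
      show ?thesis unfolding \<Psi>_def qth_inverse power_divide power_one inv by (simp del: minus_diff_eq)
    qed
    from this[of "s * (1 / cis t)"] show "\<Psi> (of_real (1 / sqrt q) * cis t) = - \<Psi> (s * (1 / cis t))"
      by (simp add: s_def)
  qed
  also have "\<dots> = - integral {-pi..pi} (\<lambda>t. \<Psi> (s * cis t))"
    using integral_circle_inversion[of "\<lambda>u. \<Psi> (s * u)"] by simp
  finally have zero: "integral {-pi..pi} (\<lambda>t. \<Psi> (s * cis t)) = 0"
    by simp
  define e where "e = a + b + c + d - (a*b*c + a*b*d + a*c*d + b*c*d)"
  have key: "\<Psi> (s * u) + \<Psi> (s * (1 / u)) = ((1 - a*b*c*d) * ((u + 1 / u) * aw_weight q a b c d u)
      - e * aw_weight q a b c d u) / s" if u: "norm u = 1" for u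
  proof -
    have u0: "u \<noteq> 0" using u by auto
    define w0 where "w0 = qth q (of_real q) (u\<^sup>2) / (qth q a u * qth q b u * qth q c u * qth q d u)"
    have w: "aw_weight q a b c d u = (1 - u\<^sup>2) * (1 - 1 / u\<^sup>2) * w0"
      unfolding aw_weight_def w0_def by (subst qth_step) simp
    have \<Psi>1: "\<Psi> (s * u) = w0 * (1 - 1 / u\<^sup>2) * ((1 - a*u) * (1 - b*u) * (1 - c*u) * (1 - d*u)) / (s * u)"
      if u: "norm u = 1" and w0: "w0 = qth q (of_real q) (u\<^sup>2) / (qth q a u * qth q b u * qth q c u * qth q d u)" for u w0
    proof -
      have u0: "u \<noteq> 0" using u by auto
      have nz: "1 - A * u \<noteq> 0" "qth q A u \<noteq> 0" if "norm A < 1" for A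
        using qth_nonzero_circle[OF that u] qth_step[of A u] by auto
      have sh: "qth q (s * A) (s * u) = qth q A u / (1 - A * u)" if "norm A < 1" for A
        using qth_shift[OF u0, of A] nz[OF that] by (simp add: s_def field_simps)
      have qn: "1 - of_real q * u\<^sup>2 \<noteq> 0"
        using q u by (metis norm_mult norm_of_real norm_one norm_power abs_of_pos mult.right_neutral order_less_irrefl power_one right_minus_eq)
      have "- (s * u - 1 / (s * u)) = (1 - of_real q * u\<^sup>2) / (s * u)"
        using s0 u0 s2 by (simp add: field_simps power2_eq_square)
      moreover have "(1 - of_real q * u\<^sup>2) * qth q (of_real q) ((s * u)\<^sup>2) = (1 - 1 / u\<^sup>2) * qth q (of_real q) (u\<^sup>2)"
      proof -
        have e: "of_real q * (s * u)\<^sup>2 = of_real q * u\<^sup>2 * of_real q" "of_real q / (s * u)\<^sup>2 = 1 / u\<^sup>2"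
          using s0 u0 q s2[symmetric] by (simp_all add: power2_eq_square)
        moreover have "qpoch_inf (1 / u\<^sup>2) q = (1 - 1 / u\<^sup>2) * qpoch_inf (of_real q / u\<^sup>2) q"
          by (subst qpoch_step[OF q]) simp
        ultimately show ?thesis
          unfolding qth_def e using qpoch_step[OF q, of "of_real q * u\<^sup>2"] by simp
      qed
      ultimately have num: "- (s * u - 1 / (s * u)) * qth q (of_real q) ((s * u)\<^sup>2) = (1 - 1 / u\<^sup>2) * qth q (of_real q) (u\<^sup>2) / (s * u)"
        by (metis (no_types, lifting) times_divide_eq_left)
      show ?thesis
        unfolding \<Psi>_def w0 num sh[OF abcd(1)] sh[OF abcd(2)] sh[OF abcd(3)] sh[OF abcd(4)]
        by (simp add: mult_ac)
    qed
    have "w0 = qth q (of_real q) ((1/u)\<^sup>2) / (qth q a (1/u) * qth q b (1/u) * qth q c (1/u) * qth q d (1/u))"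
      by (simp add: w0_def power_divide qth_inverse)
    then have \<Psi>2: "\<Psi> (s * (1/u)) = w0 * (1 - 1 / (1/u)\<^sup>2)
        * ((1 - a*(1/u)) * (1 - b*(1/u)) * (1 - c*(1/u)) * (1 - d*(1/u))) / (s * (1/u))"
      by (intro \<Psi>1) (use u in \<open>simp_all add: norm_divide\<close>)
    have "\<Psi> (s * u) + \<Psi> (s * (1 / u)) = w0 / s * ((1 - 1 / u\<^sup>2) / u * ((1 - a*u) * (1 - b*u) * (1 - c*u) * (1 - d*u))
        + (1 - u\<^sup>2) * u * ((1 - a/u) * (1 - b/u) * (1 - c/u) * (1 - d/u)))"
      unfolding \<Psi>2 \<Psi>1[OF u w0_def] by (simp add: power_divide distrib_left mult_ac)
    also have "(1 - 1 / u\<^sup>2) / u * ((1 - a*u) * (1 - b*u) * (1 - c*u) * (1 - d*u))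
        + (1 - u\<^sup>2) * u * ((1 - a/u) * (1 - b/u) * (1 - c/u) * (1 - d/u))
        = (1 - u\<^sup>2) * (1 - 1 / u\<^sup>2) * ((1 - a*b*c*d) * (u + 1/u) - e)"
    proof -
      define e\<^sub>1 e\<^sub>2 e\<^sub>3 e\<^sub>4 where "e\<^sub>1 = a + b + c + d" and "e\<^sub>2 = a*b + a*c + a*d + b*c + b*d + c*d"
        and "e\<^sub>3 = a*b*c + a*b*d + a*c*d + b*c*d" and "e\<^sub>4 = a*b*c*d"
      have P: "(1 - a * x) * (1 - b * x) * (1 - c * x) * (1 - d * x) = 1 - e\<^sub>1 * x + e\<^sub>2 * x^2 - e\<^sub>3 * x^3 + e\<^sub>4 * x^4" for x
        unfolding e\<^sub>1_def e\<^sub>2_def e\<^sub>3_def e\<^sub>4_def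
        by (simp add: algebra_simps power2_eq_square power3_eq_cube power4_eq_xxxx)
      have e: "e = e\<^sub>1 - e\<^sub>3" "a*b*c*d = e\<^sub>4" by (simp_all add: e_def e\<^sub>1_def e\<^sub>3_def e\<^sub>4_def)
      \<comment> \<open>With \<open>v\<close> for \<open>1 / u\<close> and elementary symmetric
        functions for the parameters, the claim is a polynomial identity modulo
        \<open>u * v = 1\<close>.\<close>
      have "u * v = 1 \<Longrightarrow> (1 - v^2) * v * ((1 - a * u) * (1 - b * u) * (1 - c * u) * (1 - d * u))
        + (1 - u\<^sup>2) * u * ((1 - a * v) * (1 - b * v) * (1 - c * v) * (1 - d * v))
        = (1 - u\<^sup>2) * (1 - v\<^sup>2) * ((1 - a*b*c*d) * (u + v) - e)" for v
        unfolding P e by algebra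
      from this[of "1 / u"] show ?thesis using u0 by (simp add: power_divide)
    qed
    finally have "\<Psi> (s * u) + \<Psi> (s * (1 / u))
        = w0 / s * ((1 - u\<^sup>2) * (1 - 1 / u\<^sup>2) * ((1 - a*b*c*d) * (u + 1/u) - e))" .
    moreover have "w0 / s * (X * (k * Y - e)) = (k * (Y * (X * w0)) - e * (X * w0)) / s" for X Y k
      by (simp add: right_diff_distrib diff_divide_distrib mult_ac)
    ultimately show ?thesis unfolding w by simp
  qed
  have int\<Psi>: "(\<lambda>t. \<Psi> (s * cis t)) integrable_on {-pi..pi}"
  proof (intro integrable_continuous_interval continuous_on_compose2[OF holomorphic_on_imp_continuous_on[OF \<open>\<Psi> holomorphic_on S\<close>]])
    show "(\<lambda>t. s * cis t) ` {-pi..pi} \<subseteq> S"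
      using seg by (force simp: s_def)
  qed (auto intro!: continuous_intros)
  have "(\<lambda>t. \<Psi> (s * cis (- t))) integrable_on {-pi..pi}"
    using Henstock_Kurzweil_Integration.integrable_reflect_real[where f = "\<lambda>t. \<Psi> (s * cis t)" and b = pi and a = "-pi"] int\<Psi> by simp
  moreover have "cis (- t) = 1 / cis t" for t
    by (metis cis_inverse inverse_eq_divide)
  ultimately have int\<Psi>': "(\<lambda>t. \<Psi> (s * (1 / cis t))) integrable_on {-pi..pi}"
    by simp
  have "0 = integral {-pi..pi} (\<lambda>t. \<Psi> (s * cis t)) + integral {-pi..pi} (\<lambda>t. \<Psi> (s * (1 / cis t)))"
    using zero integral_circle_inversion[of "\<lambda>u. \<Psi> (s * u)"] by simp
  also have "\<dots> = integral {-pi..pi} (\<lambda>t. \<Psi> (s * cis t) + \<Psi> (s * (1 / cis t)))"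
    by (rule integral_add[OF int\<Psi> int\<Psi>', symmetric])
  also have "\<dots> = integral {-pi..pi} (\<lambda>t. ((1 - a*b*c*d) * ((cis t + 1 / cis t) * aw_weight q a b c d (cis t))
      - e * aw_weight q a b c d (cis t)) / s)"
    by (rule integral_cong) (simp only: key norm_cis)
  also have "\<dots> = ((1 - a*b*c*d) * integral {-pi..pi} (\<lambda>t. (cis t + 1 / cis t) * aw_weight q a b c d (cis t))
      - e * aw_integral q a b c d) / s"
    using aw_weight_integrable[OF abcd]
    by (simp only: integral_divide integral_diff integral_mult_right integrable_on_mult_right aw_integral_def)
  finally show ?thesis using s0 by (simp add: e_def)
qed

end

section \<open>Parameter recursion and the value of the integral\<close>

definition aw_factor :: "real \<Rightarrow> complex \<Rightarrow> complex \<Rightarrow> complex \<Rightarrow> complex \<Rightarrow> complex" where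
  "aw_factor q a b c d = qpoch_inf (a*b) q * qpoch_inf (a*c) q * qpoch_inf (a*d) q
     * qpoch_inf (b*c) q * qpoch_inf (b*d) q * qpoch_inf (c*d) q / qpoch_inf (a*b*c*d) q"

lemma aw_integral_commute:
  "aw_integral q a b c d = aw_integral q b a c d"
  "aw_integral q a b c d = aw_integral q c b a d"
  "aw_integral q a b c d = aw_integral q d b c a"
  by (simp_all add: aw_integral_def aw_weight_def mult_ac)

lemma aw_factor_commute:
  "aw_factor q a b c d = aw_factor q b a c d"
  "aw_factor q a b c d = aw_factor q c b a d"
  "aw_factor q a b c d = aw_factor q d b c a"
  by (simp_all add: aw_factor_def mult_ac)

context
  fixes q :: real
  assumes q: "0 < q" "q < 1"
begin

lemma norm_mult_q_less_1: "norm A < 1 \<Longrightarrow> norm (A * complex_of_real q) < 1"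
  using q by (intro norm_mult_less_1) auto

text \<open>Replacing \<open>a\<close> by \<open>q a\<close> multiplies the weight by
  \<open>(1 - a u)(1 - a / u) = 1 + a^2 - a (u + 1 / u)\<close>, so the new integral is a
  combination of the old one and its first moment, which is known.\<close>

lemma aw_integral_step:
  assumes abcd: "norm a < 1" "norm b < 1" "norm c < 1" "norm d < 1"
  shows "(1 - a*b*c*d) * aw_integral q (a * of_real q) b c d
       = (1 - a*b) * (1 - a*c) * (1 - a*d) * aw_integral q a b c d"
proof -
  define M where "M = integral {-pi..pi} (\<lambda>t. (cis t + 1 / cis t) * aw_weight q a b c d (cis t))"
  have w: "aw_weight q (a * of_real q) b c d u = (1 + a\<^sup>2) * aw_weight q a b c d u
      - a * ((u + 1 / u) * aw_weight q a b c d u)" if u: "norm u = 1" for u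
  proof -
    have "qth q a u \<noteq> 0" using abcd(1) u by (rule qth_nonzero_circle[OF q])
    then have nz: "1 - a * u \<noteq> 0" "1 - a / u \<noteq> 0" "qth q (a * of_real q) u \<noteq> 0"
      using qth_step[OF q, of a u] by auto
    have "aw_weight q (a * of_real q) b c d u = (1 - a * u) * (1 - a / u) * aw_weight q a b c d u"
      unfolding aw_weight_def qth_step[OF q, of a u] using nz by auto
    also have "(1 - a * u) * (1 - a / u) = 1 + a\<^sup>2 - a * (u + 1 / u)"
      using u by (cases "u = 0") (auto simp: field_simps power2_eq_square)
    finally show ?thesis by (simp add: algebra_simps)
  qed
  have "aw_integral q (a * of_real q) b c d = (1 + a\<^sup>2) * aw_integral q a b c d - a * M"
  proof -
    have "aw_integral q (a * of_real q) b c d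
        = integral {-pi..pi} (\<lambda>t. (1 + a\<^sup>2) * aw_weight q a b c d (cis t)
            - a * ((cis t + 1 / cis t) * aw_weight q a b c d (cis t)))"
      unfolding aw_integral_def by (rule integral_cong) (simp only: w norm_cis)
    also have "\<dots> = (1 + a\<^sup>2) * aw_integral q a b c d - a * M"
      using aw_weight_integrable[OF q abcd]
      by (simp only: integral_diff integral_mult_right integrable_on_mult_right aw_integral_def M_def)
    finally show ?thesis .
  qed
  moreover have "(1 - a*b*c*d) * M
       = (a + b + c + d - (a*b*c + a*b*d + a*c*d + b*c*d)) * aw_integral q a b c d"
    unfolding M_def by (rule aw_integral_first_moment[OF q abcd])
  ultimately show ?thesis by algebra
qed

text \<open>Up to a constant, \<open>aw_factor\<close> is the reciprocal of the expected value of
  the integral; multiplying by it turns the recursion into an invariance.\<close>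

lemma aw_normalized_step:
  assumes abcd: "norm a < 1" "norm b < 1" "norm c < 1" "norm d < 1"
  shows "aw_integral q (a * of_real q) b c d * aw_factor q (a * of_real q) b c d
       = aw_integral q a b c d * aw_factor q a b c d"
proof -
  have nz: "1 - x \<noteq> 0" "qpoch_inf x q \<noteq> 0" "qpoch_inf (x * of_real q) q \<noteq> 0" if "norm x < 1" for x
    using that qpoch_nonzero[OF q] norm_mult_q_less_1[OF that] by auto
  have lt: "norm (a*b) < 1" "norm (a*c) < 1" "norm (a*d) < 1" "norm (a*b*c*d) < 1"
    using abcd by (simp_all only: norm_mult_less_1)
  have st: "qpoch_inf x q = (1 - x) * qpoch_inf (x * of_real q) q" for x
    by (rule qpoch_step[OF q])
  have "aw_factor q a b c d = aw_factor q (a * of_real q) b c d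
      * ((1 - a*b) * (1 - a*c) * (1 - a*d)) / (1 - a*b*c*d)"
    unfolding aw_factor_def st[of "a*b"] st[of "a*c"] st[of "a*d"] st[of "a*b*c*d"]
    using nz[OF lt(4)] by (simp add: mult_ac)
  moreover have "aw_integral q (a * of_real q) b c d
      = (1 - a*b) * (1 - a*c) * (1 - a*d) * aw_integral q a b c d / (1 - a*b*c*d)"
    using aw_integral_step[OF abcd] nz(1)[OF lt(4)] by (simp add: field_simps)
  ultimately show ?thesis by simp
qed

text \<open>By symmetry each parameter can be moved to the first slot, where the one-parameter step
  acts.\<close>

lemma aw_normalized_step_all:
  assumes abcd: "norm a < 1" "norm b < 1" "norm c < 1" "norm d < 1"
  defines "J \<equiv> (\<lambda>a b c d. aw_integral q a b c d * aw_factor q a b c d)"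
  defines "r \<equiv> complex_of_real q"
  shows "J (a * r) (b * r) (c * r) (d * r) = J a b c d"
proof -
  have sym: "J a b c d = J b a c d" "J a b c d = J c b a d" "J a b c d = J d b c a" for a b c d
    unfolding J_def
    by (subst aw_integral_commute(1), subst aw_factor_commute(1), rule refl)
       (subst aw_integral_commute(2), subst aw_factor_commute(2), rule refl,
        subst aw_integral_commute(3), subst aw_factor_commute(3), rule refl)
  have st: "J (a * r) b c d = J a b c d"
    if "norm a < 1" "norm b < 1" "norm c < 1" "norm d < 1" for a b c d
    using aw_normalized_step[OF that] by (simp add: J_def r_def)
  have lt: "norm (x * r) < 1" if "norm x < 1" for x
    using norm_mult_q_less_1[OF that] by (simp add: r_def)
  have "J (a * r) (b * r) (c * r) (d * r) = J a (b * r) (c * r) (d * r)"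
    using abcd by (intro st lt)
  also have "\<dots> = J (b * r) a (c * r) (d * r)" by (rule sym)
  also have "\<dots> = J b a (c * r) (d * r)" using abcd by (intro st lt)
  also have "\<dots> = J (c * r) a b (d * r)" by (rule sym(2))
  also have "\<dots> = J c a b (d * r)" using abcd by (intro st lt)
  also have "\<dots> = J (d * r) a b c" by (rule sym(3))
  also have "\<dots> = J d a b c" using abcd by (intro st lt)
  also have "\<dots> = J c a b d" by (rule sym(3))
  also have "\<dots> = J b a c d" by (rule sym(2))
  also have "\<dots> = J a b c d" by (rule sym(1))
  finally show ?thesis .
qed

text \<open>Along the ray \<open>s \<mapsto> (a s, b s, c s, d s)\<close> the normalized integral is
  continuous on \<open>{0..1}\<close> and takes the same value at all \<open>s = q^n\<close>. These
  points tend to \<open>0\<close>, so the value at \<open>1\<close> is the value at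
  \<open>0\<close>.\<close>

lemma aw_normalized_constant:
  assumes abcd: "norm a < 1" "norm b < 1" "norm c < 1" "norm d < 1"
  shows "aw_integral q a b c d * aw_factor q a b c d = aw_integral q 0 0 0 0"
proof -
  define J where "J s = aw_integral q (a * of_real s) (b * of_real s) (c * of_real s) (d * of_real s)
      * aw_factor q (a * of_real s) (b * of_real s) (c * of_real s) (d * of_real s)" for s :: real
  have lt: "norm (x * of_real s) < 1" if "norm x < 1" "s \<in> {0..1}" for x :: complex and s
    using that by (simp add: norm_mult) (smt (verit) mult_left_le norm_ge_zero)
  have "continuous_on {0..1} J"
    unfolding J_def
  proof (rule continuous_on_mult)
    show "continuous_on {0..1} (\<lambda>s. aw_integral q (a * of_real s) (b * of_real s) (c * of_real s) (d * of_real s))"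
      unfolding aw_integral_def box_real(2)[symmetric]
    proof (rule integral_continuous_on_param)
      have "qth q (x * of_real s) (cis t) \<noteq> 0" if "norm x < 1" "0 \<le> s" "s \<le> 1" for x s t
        using lt[OF that(1), of s] that by (intro qth_nonzero_circle[OF q]) auto
      with abcd      show "continuous_on (cbox 0 1 \<times> cbox (- pi) pi) (\<lambda>(s, t).
          aw_weight q (a * of_real s) (b * of_real s) (c * of_real s) (d * of_real s) (cis t))"
        unfolding aw_weight_def case_prod_unfold
        by (intro continuous_intros q) auto
    qed
    have "qpoch_inf ((a * of_real s) * (b * of_real s) * (c * of_real s) * (d * of_real s)) q \<noteq> 0"
      if "s \<in> {0..1}" for s
      using abcd that by (intro qpoch_nonzero[OF q] norm_mult_less_1 lt)
    then show "continuous_on {0..1} (\<lambda>s. aw_factor q (a * of_real s) (b * of_real s) (c * of_real s) (d * of_real s))"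
      unfolding aw_factor_def by (intro continuous_intros q) blast
  qed
  have pw: "q ^ n \<in> {0..1}" for n
    using q by (auto simp: power_le_one)
  have "J (q ^ n) = J 1" for n
  proof (induction n)
    case (Suc n)
    have "J (q ^ Suc n) = J (q ^ n)"
      using aw_normalized_step_all[OF lt[OF abcd(1) pw] lt[OF abcd(2) pw] lt[OF abcd(3) pw] lt[OF abcd(4) pw], of n n n n]
      unfolding J_def by (simp add: mult_ac)
    with Suc show ?case by simp
  qed auto
  moreover have "(\<lambda>n. J (q ^ n)) \<longlonglongrightarrow> J 0"
  proof (rule continuous_on_tendsto_compose[OF \<open>continuous_on {0..1} J\<close>])
    show "(\<lambda>n. q ^ n) \<longlonglongrightarrow> 0" using q by (intro LIMSEQ_realpow_zero) auto
  qed (use pw in auto)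
  ultimately have "J 1 = J 0" by (simp add: LIMSEQ_const_iff)
  moreover have "J 0 = aw_integral q 0 0 0 0"
    using q by (simp add: J_def aw_factor_def qpoch_0)
  ultimately show ?thesis by (simp add: J_def)
qed

text \<open>For the parameters \<open>\<surd>q, -\<surd>q, q, -q\<close> the weight collapses to \<open>(1 - z\<^sup>2)(1 - z\<^sup>-\<^sup>2)\<close>.\<close>

lemma aw_integral_0: "aw_integral q 0 0 0 0 * qpoch_inf (of_real q) q = of_real (4 * pi)"
proof -
  define s where "s = complex_of_real (sqrt q)"
  have s2: "s\<^sup>2 = of_real q" using q by (simp add: s_def flip: of_real_power)
  have ns: "norm s < 1" "norm (of_real q :: complex) < 1" using q by (simp_all add: s_def)
  have sq: "qpoch_inf (A\<^sup>2) q = qpoch_inf A q * qpoch_inf (- A) q * qpoch_inf (A * s) q * qpoch_inf (- A * s) q" for A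
    unfolding s_def by (rule qpoch_square[OF q])
  have w: "aw_weight q s (- s) (of_real q) (- of_real q) u = (1 - u\<^sup>2) * (1 - 1 / u\<^sup>2)" if u: "norm u = 1" for u
  proof -
    have "qpoch_inf (of_real q * u\<^sup>2) q = qpoch_inf ((s * u)\<^sup>2) q"
      by (simp add: power_mult_distrib s2)
    also have "\<dots> = qpoch_inf (s * u) q * qpoch_inf (- (s * u)) q * qpoch_inf (of_real q * u) q * qpoch_inf (- (of_real q * u)) q"
      unfolding sq by (simp add: s2[symmetric] power2_eq_square mult_ac)
    finally have 1: "qpoch_inf (of_real q * u\<^sup>2) q = \<dots>" .
    have "qpoch_inf (of_real q / u\<^sup>2) q = qpoch_inf ((s / u)\<^sup>2) q"
      by (simp add: power_divide s2)
    also have "\<dots> = qpoch_inf (s / u) q * qpoch_inf (- (s / u)) q * qpoch_inf (of_real q / u) q * qpoch_inf (- (of_real q / u)) q"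
      unfolding sq by (simp add: s2[symmetric] power2_eq_square mult_ac)
    finally have "qth q (of_real q) (u\<^sup>2) = qth q s u * qth q (- s) u * qth q (of_real q) u * qth q (- of_real q) u"
      unfolding qth_def 1 by (simp add: mult_ac)
    moreover have "qth q s u \<noteq> 0" "qth q (- s) u \<noteq> 0" "qth q (of_real q) u \<noteq> 0" "qth q (- of_real q) u \<noteq> 0"
      using ns u by (simp_all add: qth_nonzero_circle[OF q])
    ultimately show ?thesis
      unfolding aw_weight_def by (subst qth_step[OF q]) simp
  qed
  have "aw_integral q s (- s) (of_real q) (- of_real q) = integral {-pi..pi} (\<lambda>t. of_real (2 - 2 * cos (2 * t)))"
    unfolding aw_integral_def
  proof (rule integral_cong)
    fix t
    have "(1 - (cis t)\<^sup>2) * (1 - 1 / (cis t)\<^sup>2) = (1 - cis (2 * t)) * (1 - cis (- (2 * t)))"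
      by (simp only: Complex.DeMoivre cis_inverse inverse_eq_divide[symmetric]) simp
    also have "\<dots> = of_real (2 - 2 * cos (2 * t))"
      by (simp add: complex_eq_iff algebra_simps flip: power2_eq_square)
    finally show "aw_weight q s (- s) (of_real q) (- of_real q) (cis t) = of_real (2 - 2 * cos (2 * t))"
      by (simp add: w)
  qed
  also have "((\<lambda>t. complex_of_real (2 - 2 * cos (2 * t))) has_integral
      of_real ((2 * pi - sin (2 * pi)) - (2 * (- pi) - sin (2 * (- pi))))) {-pi..pi}"
    by (intro has_integral_of_real fundamental_theorem_of_calculus)
       (auto intro!: derivative_eq_intros simp flip: has_real_derivative_iff_has_vector_derivative)
  then have "integral {-pi..pi} (\<lambda>t. complex_of_real (2 - 2 * cos (2 * t))) = of_real (4 * pi)"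
    by (simp add: integral_unique)
  finally have I: "aw_integral q s (- s) (of_real q) (- of_real q) = of_real (4 * pi)" .
  have snz: "s \<noteq> 0" using q by (simp add: s_def)
  define Q where "Q = complex_of_real q"
  have ss: "s * s = Q" using s2 by (simp add: power2_eq_square Q_def)
  have st: "qpoch_inf A q = (1 - A) * qpoch_inf (A * Q) q" for A
    unfolding Q_def by (rule qpoch_step[OF q])
  define E F G P where "E = qpoch_inf (- Q) q" and "F = qpoch_inf (s * Q) q" and "G = qpoch_inf (- s * Q) q"
    and "P = qpoch_inf (Q * Q * Q) q"
  have F: "qpoch_inf s q = (1 - s) * F" unfolding F_def by (rule st)
  have G: "qpoch_inf (- s) q = (1 + s) * G" unfolding G_def by (subst st) simp
  have E: "E = (1 + Q) * qpoch_inf (- (Q * Q)) q" unfolding E_def by (subst st) simp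
  have P: "qpoch_inf Q q = (1 - Q) * ((1 - Q * Q) * P)"
    unfolding P_def using st[of Q] st[of "Q * Q"] by simp
  have nz: "qpoch_inf Q q \<noteq> 0" "1 - Q \<noteq> 0" "1 + Q \<noteq> 0"
    using qpoch_nonzero[OF q ns(2)] q by (auto simp: Q_def complex_eq_iff)
  have "qpoch_inf Q q = qpoch_inf s q * qpoch_inf (- s) q * qpoch_inf Q q * E"
    using sq[of s] by (simp add: power2_eq_square ss E_def)
  note * = this
  \<comment> \<open>Euler's identity \<open>(q;q^2)_inf (-q;q)_inf = 1\<close>. It comes from
    \<open>qpoch_square\<close> at \<open>A = s\<close>, where \<open>A^2\<close> and
    \<open>A * s\<close> are both \<open>q\<close>, so that \<open>(q;q)_inf\<close>
    cancels.\<close>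
  have Euler: "(1 - Q) * F * G * E = 1"
  proof -
    have "1 - Q = (1 - s) * (1 + s)" by (simp add: ss[symmetric] algebra_simps)
    then have "(1 - Q) * F * G * E * qpoch_inf Q q = qpoch_inf s q * qpoch_inf (- s) q * qpoch_inf Q q * E"
      unfolding F G by (simp only: mult_ac)
    with * have "(1 - Q) * F * G * E * qpoch_inf Q q = 1 * qpoch_inf Q q" by (simp only: mult_1_left)
    then show ?thesis using nz(1) mult_right_cancel by blast
  qed
  define H where "H = qpoch_inf (- (Q * Q)) q"
  have p: "s * - s * Q * - Q = Q * Q * Q" "s * - s = - Q" "s * - Q = - s * Q" "- s * - Q = s * Q" "Q * - Q = - (Q * Q)"
    by (simp_all add: ss flip: mult.assoc)
  have factor: "aw_factor q s (- s) Q (- Q) = E * F * G * G * F * H / P"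
    unfolding aw_factor_def p(1) unfolding p(2-5) E_def F_def G_def P_def H_def ..
  \<comment> \<open>Euler's product occurs twice, the second time with \<open>E\<close> written as
    \<open>(1 + Q) * H\<close>. The extra factor \<open>(1 - Q)^2 (1 + Q)\<close> is the quotient of
    \<open>(q;q)_inf\<close> by \<open>P\<close>.\<close>
  have "E * F * G * G * F * H * ((1 - Q) * (1 - Q) * (1 + Q)) = ((1 - Q) * F * G * E) * ((1 - Q) * F * G * ((1 + Q) * H))"
    by (simp only: mult_ac)
  also have "\<dots> = 1"
    using Euler E by (simp add: H_def)
  finally have 1: "E * F * G * G * F * H * ((1 - Q) * (1 - Q) * (1 + Q)) = 1" .
  have "P \<noteq> 0" using nz(1) P by auto
  moreover have P': "(1 - Q) * ((1 - Q * Q) * P) = ((1 - Q) * (1 - Q) * (1 + Q)) * P"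
    by (simp add: algebra_simps)
  have "x / P * (y * P) = x * y" if "P \<noteq> 0" for x y using that by simp
  ultimately have "aw_factor q s (- s) Q (- Q) * qpoch_inf Q q = 1"
    unfolding P factor P' using 1 by (simp add: mult.assoc)
  moreover have "aw_integral q s (- s) Q (- Q) * aw_factor q s (- s) Q (- Q) = aw_integral q 0 0 0 0"
    using ns by (intro aw_normalized_constant) (auto simp: Q_def)
  ultimately show ?thesis
    using I by (metis Q_def mult.assoc mult.right_neutral)
qed

theorem askey_wilson_integral:
  assumes abcd: "norm a < 1" "norm b < 1" "norm c < 1" "norm d < 1"
  shows "integral {0..pi} (\<lambda>t. aw_weight q a b c d (cis t)) * aw_factor q a b c d * qpoch_inf (of_real q) q
       = of_real (2 * pi)"
proof -
  have "2 * integral {0..pi} (\<lambda>t. aw_weight q a b c d (cis t)) = aw_integral q a b c d"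
    unfolding aw_integral_def
    by (rule integral_circle_half[symmetric]) (auto intro!: aw_weight_continuous q simp: abcd aw_weight_inverse)
  with aw_integral_0 aw_normalized_constant[OF abcd]
  have "2 * (integral {0..pi} (\<lambda>t. aw_weight q a b c d (cis t)) * aw_factor q a b c d * qpoch_inf (of_real q) q)
      = 2 * of_real (2 * pi)"
    by (simp add: mult.assoc[symmetric])
  then show ?thesis by (simp add: mult_ac)
qed

end

section \<open>Holomorphic families and their boundary jumps\<close>

lemma continuous_on_curried_subset:
  assumes "continuous_on (U \<times> T) (\<lambda>(z, t). k z t)" and "z \<in> U"
  shows "continuous_on T (k z)"
proof -
  have "continuous_on T ((\<lambda>(z, t). k z t) \<circ> Pair z)"
    by (rule continuous_on_compose) (auto intro!: continuous_intros continuous_on_subset[OF assms(1)] simp: assms(2))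
  then show ?thesis by (simp add: o_def)
qed

text \<open>Morera's theorem: Fubini moves the integral over each side of a triangle inside the
  \<open>t\<close>-integral, where Cauchy's theorem makes the three sides cancel.\<close>

lemma holomorphic_on_integral:
  fixes k :: "complex \<Rightarrow> real \<Rightarrow> complex"
  assumes U: "open U"
    and cont: "continuous_on (U \<times> {l..u}) (\<lambda>(z, t). k z t)"
    and hol: "\<And>t. t \<in> {l..u} \<Longrightarrow> (\<lambda>z. k z t) holomorphic_on U"
  shows "(\<lambda>z. integral {l..u} (k z)) holomorphic_on U"
proof -
  have swap: "contour_integral (linepath a b) (\<lambda>z. integral {l..u} (k z))
        = integral {l..u} (\<lambda>t. contour_integral (linepath a b) (\<lambda>z. k z t))"
    and int: "(\<lambda>t. contour_integral (linepath a b) (\<lambda>z. k z t)) integrable_on {l..u}"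
    if ab: "closed_segment a b \<subseteq> U" for a b
  proof -
    have lp: "linepath a b x \<in> U" if "x \<in> {0..1}" for x
      using ab that linepath_in_path by blast
    have c: "continuous_on (cbox (0, l) (1, u)) (\<lambda>(x, t). k (linepath a b x) t * (b - a))"
      unfolding case_prod_unfold cbox_Pair_eq box_real
    proof (rule continuous_on_mult_right, rule continuous_on_compose2[OF cont[unfolded case_prod_unfold], where f = "\<lambda>p. (linepath a b (fst p), snd p)", simplified])
      show "continuous_on ({0..1} \<times> {l..u}) (\<lambda>p. (linepath a b (fst p), snd p))"
        unfolding linepath_def by (intro continuous_intros)
    qed (use lp in auto)
    have c': "continuous_on ({l..u} \<times> cbox 0 1) (\<lambda>(t, x). k (linepath a b x) t * (b - a))"
    proof -
      have "continuous_on ({l..u} \<times> {0..1}) ((\<lambda>(x, t). k (linepath a b x) t * (b - a)) \<circ> prod.swap)"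
        using c by (intro continuous_on_compose) (auto intro!: continuous_intros simp: product_swap cbox_Pair_eq)
      then show ?thesis by (simp add: o_def case_prod_unfold)
    qed
    have "contour_integral (linepath a b) (\<lambda>z. integral {l..u} (k z))
        = integral (cbox 0 1) (\<lambda>x. integral (cbox l u) (\<lambda>t. k (linepath a b x) t * (b - a)))"
      by (simp add: contour_integral_integral)
    also have "\<dots> = integral (cbox l u) (\<lambda>t. integral (cbox 0 1) (\<lambda>x. k (linepath a b x) t * (b - a)))"
      by (rule integral_swap_continuous[OF c])
    finally show "contour_integral (linepath a b) (\<lambda>z. integral {l..u} (k z))
        = integral {l..u} (\<lambda>t. contour_integral (linepath a b) (\<lambda>z. k z t))"
      by (simp add: contour_integral_integral)
    show "(\<lambda>t. contour_integral (linepath a b) (\<lambda>z. k z t)) integrable_on {l..u}"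
      using integral_continuous_on_param[OF c'] by (simp add: contour_integral_integral integrable_continuous_interval)
  qed
  have "(\<lambda>z. integral {l..u} (k z)) analytic_on U"
  proof (rule Morera_triangle[OF _ U])
    show "continuous_on U (\<lambda>z. integral {l..u} (k z))"
      using integral_continuous_on_param[of U l u k] cont by simp
    show "convex hull {a, b, c} \<subseteq> U \<longrightarrow> contour_integral (linepath a b) (\<lambda>z. integral {l..u} (k z))
        + contour_integral (linepath b c) (\<lambda>z. integral {l..u} (k z))
        + contour_integral (linepath c a) (\<lambda>z. integral {l..u} (k z)) = 0" for a b c
    proof
      assume abc: "convex hull {a, b, c} \<subseteq> U"
      have seg: "closed_segment a b \<subseteq> U" "closed_segment b c \<subseteq> U" "closed_segment c a \<subseteq> U"
      proof -
        have "closed_segment x y \<subseteq> convex hull {a, b, c}" if "x \<in> {a, b, c}" "y \<in> {a, b, c}" for x y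
          unfolding segment_convex_hull by (rule hull_mono) (use that in auto)
        with abc show "closed_segment a b \<subseteq> U" "closed_segment b c \<subseteq> U" "closed_segment c a \<subseteq> U"
          by blast+
      qed
      have "integral {l..u} (\<lambda>t. contour_integral (linepath a b) (\<lambda>z. k z t)
          + contour_integral (linepath b c) (\<lambda>z. k z t) + contour_integral (linepath c a) (\<lambda>z. k z t))
        = integral {l..u} (\<lambda>t. 0)"
      proof (rule integral_cong)
        fix t assume t: "t \<in> {l..u}"
        have ci: "(\<lambda>z. k z t) contour_integrable_on linepath x y" if "closed_segment x y \<subseteq> U" for x y
          using that holomorphic_on_imp_continuous_on[OF hol[OF t]]
          by (intro contour_integrable_continuous_linepath) (rule continuous_on_subset)
        have "((\<lambda>z. k z t) has_contour_integral 0) (linepath a b +++ linepath b c +++ linepath c a)"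
          by (rule Cauchy_theorem_triangle) (rule holomorphic_on_subset[OF hol[OF t] abc])
        from contour_integral_unique[OF this] ci[OF seg(1)] ci[OF seg(2)] ci[OF seg(3)]
        show "contour_integral (linepath a b) (\<lambda>z. k z t)
          + contour_integral (linepath b c) (\<lambda>z. k z t) + contour_integral (linepath c a) (\<lambda>z. k z t) = 0"
          by (simp add: contour_integral_join contour_integrable_join add.assoc)
      qed
      then show "contour_integral (linepath a b) (\<lambda>z. integral {l..u} (k z))
          + contour_integral (linepath b c) (\<lambda>z. integral {l..u} (k z))
          + contour_integral (linepath c a) (\<lambda>z. integral {l..u} (k z)) = 0"
        using int seg by (simp add: swap integral_add integrable_add)
    qed
  qed
  then show ?thesis using analytic_imp_holomorphic by blast
qed

text \<open>Joint continuity gives one bound on the compact set \<open>cball z e \<times> T\<close>,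
  and Cauchy's inequality on discs of radius \<open>e / 2\<close> turns it into a derivative bound
  uniform in \<open>t\<close>. The jump computation needs this uniformity, since there
  \<open>t\<close> is integrated while \<open>w\<close> approaches \<open>z\<close>.\<close>

lemma holomorphic_family_Lipschitz:
  fixes M :: "complex \<Rightarrow> 'a::topological_space \<Rightarrow> complex"
  assumes W: "open W" "z \<in> W" and T: "compact T"
    and cont: "continuous_on (W \<times> T) (\<lambda>(w, t). M w t)"
    and hol: "\<And>t. t \<in> T \<Longrightarrow> (\<lambda>w. M w t) holomorphic_on W"
  obtains L \<delta> where "0 < \<delta>" "0 \<le> L" "ball z \<delta> \<subseteq> W"
    "\<And>w t. w \<in> ball z \<delta> \<Longrightarrow> t \<in> T \<Longrightarrow> norm (M w t - M z t) \<le> L * norm (w - z)"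
proof -
  obtain e where e: "0 < e" "cball z e \<subseteq> W"
    using W open_contains_cball by blast
  define \<delta> where "\<delta> = e / 2"
  have \<delta>: "0 < \<delta>" "\<delta> < e" using e by (auto simp: \<delta>_def)
  have "compact ((\<lambda>(w, t). M w t) ` (cball z e \<times> T))"
    using e T by (intro compact_continuous_image continuous_on_subset[OF cont] compact_Times) auto
  then obtain B where B: "0 < B" "\<And>p. p \<in> cball z e \<times> T \<Longrightarrow> norm ((\<lambda>(w, t). M w t) p) \<le> B"
    by (metis (no_types, lifting) compact_imp_bounded bounded_pos imageI)
  have "norm (M w t - M z t) \<le> (B / \<delta>) * norm (w - z)" if "w \<in> ball z \<delta>" "t \<in> T" for w t
  proof (rule field_differentiable_bound[where S = "ball z \<delta>" and f' = "deriv (\<lambda>w. M w t)"])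
    fix u assume u: "u \<in> ball z \<delta>"
    have sub: "cball u \<delta> \<subseteq> cball z e"
    proof
      fix x assume "x \<in> cball u \<delta>"
      then show "x \<in> cball z e"
        using u dist_triangle[of z x u] by (simp add: \<delta>_def)
    qed
    have "u \<in> W" using u \<delta> e by auto
    then show "((\<lambda>w. M w t) has_field_derivative deriv (\<lambda>w. M w t) u) (at u within ball z \<delta>)"
      using holomorphic_derivI[OF hol[OF that(2)] W(1)] has_field_derivative_at_within by blast
    have "norm ((deriv ^^ 1) (\<lambda>w. M w t) u) \<le> fact 1 * B / \<delta> ^ 1"
    proof (rule Cauchy_inequality)
      show "(\<lambda>w. M w t) holomorphic_on ball u \<delta>"
        using hol[OF that(2)] by (rule holomorphic_on_subset) (use sub e ball_subset_cball in blast)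
      show "continuous_on (cball u \<delta>) (\<lambda>w. M w t)"
        using holomorphic_on_imp_continuous_on[OF hol[OF that(2)]] by (rule continuous_on_subset) (use sub e in blast)
      show "norm (M x t) \<le> B" if "norm (u - x) = \<delta>" for x
        using B(2)[of "(x, t)"] sub that \<open>t \<in> T\<close> by (auto simp: dist_norm)
    qed (use \<delta> in auto)
    then show "norm (deriv (\<lambda>w. M w t) u) \<le> B / \<delta>" by simp
  qed (use that \<delta> in auto)
  moreover have "ball z \<delta> \<subseteq> W" using \<delta> e by (auto simp: subset_iff)
  ultimately show ?thesis
    using that[of \<delta> "B / \<delta>"] \<delta> B(1) by auto
qed

section \<open>The Poisson kernel of the half plane as an approximate identity\<close>

definition poisson_sin :: "real \<Rightarrow> real \<Rightarrow> real \<Rightarrow> real" where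
  "poisson_sin \<xi> \<eta> t = sin t * \<eta> / ((\<xi> - cos t)\<^sup>2 + \<eta>\<^sup>2)"

lemma poisson_sin_continuous: "0 < \<eta> \<Longrightarrow> continuous_on S (poisson_sin \<xi> \<eta>)"
  unfolding poisson_sin_def
  by (intro continuous_intros) (metis add_nonneg_eq_0_iff less_irrefl power_not_zero zero_le_power2)

lemma poisson_sin_nonneg: "0 < \<eta> \<Longrightarrow> t \<in> {0..pi} \<Longrightarrow> 0 \<le> poisson_sin \<xi> \<eta> t"
  by (auto simp: poisson_sin_def sin_ge_zero)

text \<open>The factor \<open>sin t\<close> is the Jacobian of \<open>y = cos t\<close>, so this is
  the mass on \<open>[-1,1]\<close> of the half-plane Poisson kernel without its usual
  \<open>1 / pi\<close>. Each arctangent is below \<open>pi / 2\<close>, and tends to it as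
  \<open>\<eta> \<rightarrow> 0\<close> with \<open>\<xi>\<close> tending to an interior point: the
  total mass tends to \<open>pi\<close>.\<close>

lemma poisson_sin_has_integral:
  assumes "0 < \<eta>"
  shows "(poisson_sin \<xi> \<eta> has_integral arctan ((\<xi> + 1) / \<eta>) + arctan ((1 - \<xi>) / \<eta>)) {0..pi}"
proof -
  have "((\<lambda>t. arctan ((\<xi> - cos t) / \<eta>)) has_vector_derivative poisson_sin \<xi> \<eta> t) (at t within {0..pi})" for t
  proof -
    have "\<eta>\<^sup>2 + (\<xi> - cos t)\<^sup>2 \<noteq> 0"
      using assms by (metis add_nonneg_eq_0_iff less_irrefl power_not_zero zero_le_power2)
    then have "inverse (1 + ((\<xi> - cos t) / \<eta>)\<^sup>2) * (sin t / \<eta>) = poisson_sin \<xi> \<eta> t"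
      using assms by (simp add: poisson_sin_def field_simps power2_eq_square)
    moreover have "((\<lambda>t. arctan ((\<xi> - cos t) / \<eta>)) has_real_derivative inverse (1 + ((\<xi> - cos t) / \<eta>)\<^sup>2) * (sin t / \<eta>)) (at t within {0..pi})"
      using assms by (auto intro!: derivative_eq_intros)
    ultimately show ?thesis by (simp add: has_real_derivative_iff_has_vector_derivative)
  qed
  from fundamental_theorem_of_calculus[OF _ this]
  have "(poisson_sin \<xi> \<eta> has_integral (arctan ((\<xi> + 1) / \<eta>) - arctan ((\<xi> - 1) / \<eta>))) {0..pi}"
    by simp
  moreover have "arctan ((\<xi> - 1) / \<eta>) = - arctan ((1 - \<xi>) / \<eta>)"
    by (metis arctan_minus minus_diff_eq minus_divide_left)
  ultimately show ?thesis by simp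
qed

lemma poisson_sin_integral_le:
  assumes "0 < \<eta>"
  shows "integral {0..pi} (poisson_sin \<xi> \<eta>) \<le> pi"
  using integral_unique[OF poisson_sin_has_integral[OF assms, of \<xi>]]
    arctan_ubound[of "(\<xi> + 1) / \<eta>"] arctan_ubound[of "(1 - \<xi>) / \<eta>"] by linarith

lemma poisson_sin_integral_tendsto:
  assumes \<xi>: "(\<xi> \<longlongrightarrow> x) F" and x: "-1 < x" "x < 1"
    and \<eta>: "(\<eta> \<longlongrightarrow> 0) F" and pos: "eventually (\<lambda>n. 0 < \<eta> n) F"
  shows "((\<lambda>n. integral {0..pi} (poisson_sin (\<xi> n) (\<eta> n))) \<longlongrightarrow> pi) F"
proof -
  have "filterlim (\<lambda>n. (\<xi> n + 1) / \<eta> n) at_top F" "filterlim (\<lambda>n. (1 - \<xi> n) / \<eta> n) at_top F"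
    using x by (auto intro!: LIM_at_top_divide[OF _ _ \<eta> pos] tendsto_intros \<xi>)
  then have "((\<lambda>n. arctan ((\<xi> n + 1) / \<eta> n) + arctan ((1 - \<xi> n) / \<eta> n)) \<longlongrightarrow> pi / 2 + pi / 2) F"
    by (intro tendsto_add filterlim_compose[OF tendsto_arctan_at_top])
  moreover have "eventually (\<lambda>n. arctan ((\<xi> n + 1) / \<eta> n) + arctan ((1 - \<xi> n) / \<eta> n)
      = integral {0..pi} (poisson_sin (\<xi> n) (\<eta> n))) F"
    using pos by eventually_elim (simp add: integral_unique[OF poisson_sin_has_integral])
  ultimately show ?thesis
    by (auto intro: Lim_transform_eventually)
qed

text \<open>Closeness is measured between cosines, since the kernel sees only \<open>cos t\<close>;
  hence the continuity of \<open>v\<close> composed with \<open>arccos\<close>. Where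
  \<open>cos t\<close> is within \<open>\<delta>\<close> of \<open>cos \<theta>\<close>, the mass
  bound \<open>pi\<close> applies; elsewhere the kernel is at most
  \<open>4 \<eta> / \<delta>^2\<close> once \<open>\<xi>\<close> is within
  \<open>\<delta> / 2\<close> of \<open>cos \<theta>\<close>.\<close>

lemma poisson_sin_tendsto:
  fixes v :: "real \<Rightarrow> complex"
  assumes v: "continuous_on {0..pi} v" and \<theta>: "0 < \<theta>" "\<theta> < pi"
    and \<xi>: "(\<xi> \<longlongrightarrow> cos \<theta>) F" and \<eta>: "(\<eta> \<longlongrightarrow> 0) F" and pos: "eventually (\<lambda>n. 0 < \<eta> n) F"
  shows "((\<lambda>n. integral {0..pi} (\<lambda>t. v t * of_real (poisson_sin (\<xi> n) (\<eta> n) t))) \<longlongrightarrow> of_real pi * v \<theta>) F"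
proof -
  have x: "-1 < cos \<theta>" "cos \<theta> < 1"
    using cos_monotone_0_pi[of \<theta> pi] cos_monotone_0_pi[of 0 \<theta>] \<theta> by auto
  define D where "D n = integral {0..pi} (\<lambda>t. (v t - v \<theta>) * of_real (poisson_sin (\<xi> n) (\<eta> n) t))" for n
  obtain B where B: "0 < B" "\<And>t. t \<in> {0..pi} \<Longrightarrow> norm (v t - v \<theta>) \<le> B"
  proof -
    have "compact ((\<lambda>t. v t - v \<theta>) ` {0..pi})"
      by (intro compact_continuous_image continuous_intros v) auto
    then show ?thesis using that compact_imp_bounded bounded_pos by (metis (no_types, lifting) imageI)
  qed
  have "(D \<longlongrightarrow> 0) F"
  proof (rule tendstoI)
    fix e :: real assume e: "0 < e"
    define e' where "e' = e / (2 * pi)"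
    have e': "0 < e'" using e by (simp add: e'_def)
    have "continuous_on {-1..1} (\<lambda>y. v (arccos y))"
      by (rule continuous_on_compose2[OF v]) (auto intro!: continuous_intros arccos_lbound arccos_ubound)
    with x e' have "\<exists>d>0. \<forall>y\<in>{-1..1}. dist y (cos \<theta>) < d \<longrightarrow> dist (v (arccos y)) (v (arccos (cos \<theta>))) < e'"
      by (simp add: continuous_on_iff)
    then obtain \<delta> where \<delta>: "0 < \<delta>" "\<And>y. y \<in> {-1..1} \<Longrightarrow> dist y (cos \<theta>) < \<delta> \<Longrightarrow> dist (v (arccos y)) (v (arccos (cos \<theta>))) < e'"
      by blast
    have near: "norm (v t - v \<theta>) \<le> e'" if "t \<in> {0..pi}" "\<bar>cos t - cos \<theta>\<bar> < \<delta>" for t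
      using \<delta>(2)[of "cos t"] that \<theta> by (simp add: arccos_cos dist_norm)
    have "((\<lambda>n. B * (\<eta> n * 4 / \<delta>\<^sup>2) * pi) \<longlongrightarrow> B * (0 * 4 / \<delta>\<^sup>2) * pi) F"
      by (intro tendsto_intros \<eta>) (use \<delta> in auto)
    then have "eventually (\<lambda>n. B * (\<eta> n * 4 / \<delta>\<^sup>2) * pi < e / 2) F"
      using e by (intro order_tendstoD(2)) auto
    moreover have "eventually (\<lambda>n. dist (\<xi> n) (cos \<theta>) < \<delta> / 2) F"
      using tendstoD[OF \<xi>, of "\<delta> / 2"] \<delta> by simp
    ultimately show "eventually (\<lambda>n. dist (D n) 0 < e) F"
      using pos
    proof eventually_elim
      case (elim n)
      let ?P = "poisson_sin (\<xi> n) (\<eta> n)"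
      have Pint: "?P integrable_on {0..pi}"
        using poisson_sin_has_integral[OF elim(3)] by blast
      have "norm (D n) \<le> integral {0..pi} (\<lambda>t. e' * ?P t + B * (\<eta> n * 4 / \<delta>\<^sup>2))"
        unfolding D_def
      proof (rule integral_norm_bound_integral)
        show "(\<lambda>t. (v t - v \<theta>) * of_real (?P t)) integrable_on {0..pi}"
          by (intro integrable_continuous_interval continuous_intros v poisson_sin_continuous elim)
        show "(\<lambda>t. e' * ?P t + B * (\<eta> n * 4 / \<delta>\<^sup>2)) integrable_on {0..pi}"
          by (intro integrable_continuous_interval continuous_intros poisson_sin_continuous elim)
        fix t assume t: "t \<in> {0..pi}"
        have P0: "0 \<le> ?P t" using poisson_sin_nonneg[OF elim(3) t] .
        show "norm ((v t - v \<theta>) * of_real (?P t)) \<le> e' * ?P t + B * (\<eta> n * 4 / \<delta>\<^sup>2)"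
        proof (cases "\<bar>cos t - cos \<theta>\<bar> < \<delta>")
          case True
          have "norm ((v t - v \<theta>) * of_real (?P t)) \<le> e' * ?P t"
            using near[OF t True] P0 by (simp add: norm_mult mult_right_mono)
          moreover have "0 \<le> B * (\<eta> n * 4 / \<delta>\<^sup>2)" using B elim by simp
          ultimately show ?thesis by linarith
        next
          case False
          then have "\<delta> / 2 \<le> \<bar>\<xi> n - cos t\<bar>" using elim(2) unfolding dist_real_def by linarith
          then have "(\<delta> / 2)\<^sup>2 \<le> \<bar>\<xi> n - cos t\<bar>\<^sup>2" using \<delta> by (intro power_mono) auto
          then have "(\<delta> / 2)\<^sup>2 \<le> (\<xi> n - cos t)\<^sup>2 + (\<eta> n)\<^sup>2"
            using zero_le_power2[of "\<eta> n"] unfolding power2_abs by linarith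
          then have "sin t * \<eta> n / ((\<xi> n - cos t)\<^sup>2 + (\<eta> n)\<^sup>2) \<le> 1 * \<eta> n / (\<delta> / 2)\<^sup>2"
            using elim \<delta> by (intro frac_le mult_right_mono) simp_all
          then have Ple: "?P t \<le> \<eta> n * 4 / \<delta>\<^sup>2" by (simp add: poisson_sin_def power2_eq_square mult.commute)
          then have "norm ((v t - v \<theta>) * of_real (?P t)) \<le> B * (\<eta> n * 4 / \<delta>\<^sup>2)"
            using mult_mono[OF B(2)[OF t] Ple] B(1) P0 by (simp add: norm_mult)
          moreover have "0 \<le> e' * ?P t" using e' P0 by simp
          ultimately show ?thesis by linarith
        qed
      qed
      also have "\<dots> = e' * integral {0..pi} ?P + B * (\<eta> n * 4 / \<delta>\<^sup>2) * pi"
        using Pint by (subst integral_add) (auto intro: integrable_on_mult_right)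
      also have "e' * integral {0..pi} ?P \<le> e' * pi"
        using poisson_sin_integral_le[OF elim(3)] e' by (intro mult_left_mono) auto
      also have "e' * pi = e / 2" by (simp add: e'_def)
      finally show ?case using elim(1) by simp
    qed
  qed
  moreover have "((\<lambda>n. v \<theta> * of_real (integral {0..pi} (poisson_sin (\<xi> n) (\<eta> n)))) \<longlongrightarrow> v \<theta> * of_real pi) F"
    by (intro tendsto_intros poisson_sin_integral_tendsto[OF \<xi> x \<eta> pos])
  ultimately have "((\<lambda>n. D n + v \<theta> * of_real (integral {0..pi} (poisson_sin (\<xi> n) (\<eta> n)))) \<longlongrightarrow> 0 + v \<theta> * of_real pi) F"
    by (rule tendsto_add)
  moreover have "eventually (\<lambda>n. D n + v \<theta> * of_real (integral {0..pi} (poisson_sin (\<xi> n) (\<eta> n)))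
      = integral {0..pi} (\<lambda>t. v t * of_real (poisson_sin (\<xi> n) (\<eta> n) t))) F"
    using pos
  proof eventually_elim
    case (elim n)
    let ?P = "\<lambda>t. complex_of_real (poisson_sin (\<xi> n) (\<eta> n) t)"
    have e: "v \<theta> * of_real (integral {0..pi} (poisson_sin (\<xi> n) (\<eta> n))) = integral {0..pi} (\<lambda>t. v \<theta> * ?P t)"
    proof -
      have "(?P has_integral of_real (arctan ((\<xi> n + 1) / \<eta> n) + arctan ((1 - \<xi> n) / \<eta> n))) {0..pi}"
        by (intro has_integral_of_real poisson_sin_has_integral elim)
      then show ?thesis
        using integral_unique[OF poisson_sin_has_integral[OF elim, of "\<xi> n"]] by (simp add: integral_unique)
    qed
    have i: "(\<lambda>t. (v t - v \<theta>) * ?P t) integrable_on {0..pi}" "(\<lambda>t. v \<theta> * ?P t) integrable_on {0..pi}"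
      by (intro integrable_continuous_interval continuous_intros v poisson_sin_continuous elim)+
    show ?case
      unfolding D_def e integral_add[OF i, symmetric] by (simp only: ring_distribs[symmetric] diff_add_cancel)
  qed
  ultimately have "((\<lambda>n. integral {0..pi} (\<lambda>t. v t * of_real (poisson_sin (\<xi> n) (\<eta> n) t))) \<longlongrightarrow> 0 + v \<theta> * of_real pi) F"
    by (rule Lim_transform_eventually)
  then show ?thesis by (simp only: add_0_left mult.commute)
qed

text \<open>Writing \<open>w + 1/w = 2(\<xi> + i\<eta>)\<close> for \<open>w = r e\<^sup>i\<^sup>\<theta>\<close>, the point \<open>e\<^sup>i\<^sup>\<theta>/r\<close> belongs to \<open>\<xi> - i\<eta>\<close>, so the difference of the
  two Cauchy kernels is the Poisson kernel of the half plane. The variation of \<open>M\<close> is \<open>O(\<eta>)\<close> and is absorbed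
  by \<open>\<eta>/D \<le> (\<surd>\<eta> + \<surd>\<eta> \<eta>/D\<^sup>2)/2\<close>, where \<open>D\<close> is the modulus of the denominator.\<close>

lemma cauchy_kernel_jump:
  fixes M :: "complex \<Rightarrow> real \<Rightarrow> complex" and v :: "real \<Rightarrow> complex"
  assumes v: "continuous_on {0..pi} v" and \<theta>: "0 < \<theta>" "\<theta> < pi"
    and W: "open W" "cis \<theta> \<in> W"
    and cont: "continuous_on (W \<times> {0..pi}) (\<lambda>(w, t). M w t)"
    and hol: "\<And>t. t \<in> {0..pi} \<Longrightarrow> (\<lambda>w. M w t) holomorphic_on W"
  defines "k \<equiv> \<lambda>w t. v t * of_real (sin t) * M w t / (w + 1 / w - 2 * of_real (cos t))"
  shows "((\<lambda>r. integral {0..pi} (\<lambda>t. k (of_real r * cis \<theta>) t - k (cis \<theta> / of_real r) t))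
      \<longlongrightarrow> - \<i> * of_real pi * (v \<theta> * M (cis \<theta>) \<theta>)) (at_right 1)"
proof -
  define z where "z = cis \<theta>"
  have z1: "norm z = 1" by (simp add: z_def)
  define \<xi> where "\<xi> r = cos \<theta> * (r + 1 / r) / 2" for r :: real
  define \<eta> where "\<eta> r = sin \<theta> * (r - 1 / r) / 2" for r :: real
  have sin\<theta>: "0 < sin \<theta>" using \<theta> by (simp add: sin_gt_zero)
  obtain L \<delta> where L: "0 < \<delta>" "0 \<le> L" "ball z \<delta> \<subseteq> W"
    "\<And>w t. w \<in> ball z \<delta> \<Longrightarrow> t \<in> {0..pi} \<Longrightarrow> norm (M w t - M z t) \<le> L * norm (w - z)"
    using holomorphic_family_Lipschitz[OF W _ cont hol] unfolding z_def by (metis compact_Icc)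
  obtain B where B: "0 < B" "\<And>t. t \<in> {0..pi} \<Longrightarrow> norm (v t) \<le> B"
  proof -
    have "compact (v ` {0..pi})"
      by (intro compact_continuous_image v) auto
    then show ?thesis using that compact_imp_bounded bounded_pos by (metis (no_types, lifting) imageI)
  qed
  have Mc: "continuous_on {0..pi} (M w)" if "w \<in> W" for w
    using cont that by (rule continuous_on_curried_subset)
  have zW: "z \<in> W" using W by (simp add: z_def)
  have \<xi>_lim: "(\<xi> \<longlongrightarrow> cos \<theta>) (at_right 1)"
    unfolding \<xi>_def by (auto intro!: tendsto_eq_intros)
  have \<eta>_lim: "(\<eta> \<longlongrightarrow> 0) (at_right 1)"
    unfolding \<eta>_def by (auto intro!: tendsto_eq_intros)
  have r1: "eventually (\<lambda>r::real. 1 < r) (at_right 1)"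
    by (simp add: eventually_at_right_less)
  have \<eta>_pos: "0 < \<eta> r" if "1 < r" for r
  proof -
    have "1 / r < r" using that by (smt (verit) divide_less_eq_1_pos)
    with sin\<theta> show ?thesis by (simp add: \<eta>_def)
  qed
  define N where "N r = integral {0..pi} (\<lambda>t. v t * M z t * of_real (poisson_sin (\<xi> r) (\<eta> r) t))" for r
  have "(N \<longlongrightarrow> of_real pi * (v \<theta> * M z \<theta>)) (at_right 1)"
    unfolding N_def
    using \<xi>_lim \<eta>_lim eventually_mono[OF r1 \<eta>_pos]
    by (intro poisson_sin_tendsto continuous_intros v Mc zW \<theta>) auto
  then have main: "((\<lambda>r. - \<i> * N r) \<longlongrightarrow> - \<i> * (of_real pi * (v \<theta> * M z \<theta>))) (at_right 1)"
    by (intro tendsto_intros)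
  define G where "G r = integral {0..pi} (\<lambda>t. k (of_real r * z) t - k (z / of_real r) t)" for r
  have bound: "norm (G r - - \<i> * N r) \<le> B * L / sin \<theta> * (sqrt (\<eta> r) * (2 * pi))"
    if r: "1 < r" "r < 1 + \<delta>" for r
  proof -
    define \<zeta> where "\<zeta> t = Complex (\<xi> r - cos t) (\<eta> r)" for t
    have \<eta>0: "0 < \<eta> r" using \<eta>_pos r by blast
    have \<zeta>0: "\<zeta> t \<noteq> 0" for t using \<eta>0 by (auto simp: \<zeta>_def complex_eq_iff)
    have \<zeta>n: "(norm (\<zeta> t))\<^sup>2 = (\<xi> r - cos t)\<^sup>2 + (\<eta> r)\<^sup>2" for t
      by (simp add: \<zeta>_def cmod_power2)
    have inv: "1 / z = cis (- \<theta>)"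
      by (metis z_def cis_inverse inverse_eq_divide)
    have den1: "of_real r * z + 1 / (of_real r * z) - 2 * of_real (cos t) = 2 * \<zeta> t" for t
    proof -
      have "1 / (of_real r * z) = of_real (1 / r) * cis (- \<theta>)"
        by (simp flip: inv)
      then show ?thesis using r by (simp add: complex_eq_iff z_def \<zeta>_def \<xi>_def \<eta>_def field_simps)
    qed
    have den2: "z / of_real r + 1 / (z / of_real r) - 2 * of_real (cos t) = 2 * cnj (\<zeta> t)" for t
    proof -
      have 1: "z / of_real r = of_real (1 / r) * cis \<theta>" and 2: "1 / (z / of_real r) = of_real r * cis (- \<theta>)"
        by (simp add: z_def) (simp flip: inv)
      show ?thesis unfolding 2 unfolding 1 using r by (simp add: complex_eq_iff z_def \<zeta>_def \<xi>_def \<eta>_def field_simps)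
    qed
    have w1: "of_real r * z \<in> ball z \<delta>" "norm (of_real r * z - z) = r - 1"
    proof -
      have "of_real r * z - z = of_real (r - 1) * z" by (simp add: algebra_simps)
      then show "norm (of_real r * z - z) = r - 1" using r z1 by (simp only: norm_mult norm_of_real) simp
      then show "of_real r * z \<in> ball z \<delta>" using r by (simp add: dist_norm norm_minus_commute)
    qed
    have w2: "z / of_real r \<in> ball z \<delta>" "norm (z / of_real r - z) \<le> r - 1"
    proof -
      have "z / of_real r - z = of_real (1 / r - 1) * z" by (simp add: algebra_simps)
      then have "norm (z / of_real r - z) = 1 - 1 / r" using r z1 by (simp only: norm_mult norm_of_real) simp
      also have "\<dots> \<le> r - 1"
      proof -
        have "0 \<le> (r - 1)\<^sup>2 / r" using r by simp
        also have "(r - 1)\<^sup>2 / r = r - 1 - (1 - 1 / r)" using r by (simp add: field_simps power2_eq_square)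
        finally show ?thesis by simp
      qed
      finally show "norm (z / of_real r - z) \<le> r - 1" .
      then show "z / of_real r \<in> ball z \<delta>" using r by (simp add: dist_norm norm_minus_commute)
    qed
    have W12: "of_real r * z \<in> W" "z / of_real r \<in> W" using w1 w2 L(3) by auto
    have \<zeta>c: "continuous_on {0..pi} \<zeta>" "continuous_on {0..pi} (\<lambda>t. cnj (\<zeta> t))"
      unfolding \<zeta>_def Complex_eq by (intro continuous_intros)+
    have k1: "k (of_real r * z) t = v t * of_real (sin t) * M (of_real r * z) t / (2 * \<zeta> t)"
      and k2: "k (z / of_real r) t = v t * of_real (sin t) * M (z / of_real r) t / (2 * cnj (\<zeta> t))" for t
      unfolding k_def den1 den2 by simp_all
    let ?P = "poisson_sin (\<xi> r) (\<eta> r)"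
    have kint: "(\<lambda>t. k (of_real r * z) t - k (z / of_real r) t) integrable_on {0..pi}"
      unfolding k1 k2 by (intro integrable_continuous_interval continuous_intros v Mc W12 \<zeta>c) (use \<zeta>0 in auto)
    have Nint: "(\<lambda>t. - \<i> * (v t * M z t * of_real (?P t))) integrable_on {0..pi}"
      by (intro integrable_continuous_interval continuous_intros v Mc zW poisson_sin_continuous \<eta>0)
    have GN: "G r - - \<i> * N r = integral {0..pi} (\<lambda>t. (k (of_real r * z) t - k (z / of_real r) t) - - \<i> * (v t * M z t * of_real (?P t)))"
      unfolding G_def N_def by (subst integral_diff[OF kint Nint]) (simp del: integral_mult_right add: integral_mult_right[symmetric])
    have "norm (G r - - \<i> * N r) \<le> integral {0..pi} (\<lambda>t. B * L / sin \<theta> * (sqrt (\<eta> r) * (1 + ?P t)))"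
      unfolding GN
    proof (rule integral_norm_bound_integral)
      show "(\<lambda>t. (k (of_real r * z) t - k (z / of_real r) t) - - \<i> * (v t * M z t * of_real (?P t))) integrable_on {0..pi}"
        by (rule integrable_diff[OF kint Nint])
      show "(\<lambda>t. B * L / sin \<theta> * (sqrt (\<eta> r) * (1 + ?P t))) integrable_on {0..pi}"
        by (intro integrable_continuous_interval continuous_intros poisson_sin_continuous \<eta>0)
      fix t assume t: "t \<in> {0..pi}"
      define D where "D = norm (\<zeta> t)"
      have D: "0 < D" "norm (cnj (\<zeta> t)) = D" using \<zeta>0 by (auto simp: D_def)
      have st: "0 \<le> sin t" "sin t \<le> 1" using t by (auto simp: sin_ge_zero)
      define X where "X = (\<xi> r - cos t)\<^sup>2 + (\<eta> r)\<^sup>2"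
      have "1 / (2 * \<zeta> t) - 1 / (2 * cnj (\<zeta> t)) = (cnj (\<zeta> t) - \<zeta> t) / (2 * (\<zeta> t * cnj (\<zeta> t)))"
        using \<zeta>0[of t] by (simp add: field_simps)
      also have "\<zeta> t * cnj (\<zeta> t) = of_real X"
        by (simp only: complex_norm_square[symmetric] X_def \<zeta>n)
      also have "cnj (\<zeta> t) - \<zeta> t = - 2 * \<i> * of_real (\<eta> r)"
        by (simp add: \<zeta>_def complex_eq_iff)
      finally have P: "of_real (sin t) * (1 / (2 * \<zeta> t) - 1 / (2 * cnj (\<zeta> t))) = - \<i> * of_real (?P t)"
        by (simp add: poisson_sin_def flip: X_def)
      \<comment> \<open>Freezing \<open>M\<close> at \<open>z\<close> leaves exactly the Poisson
        kernel, so the error contains only increments of \<open>M\<close>, to which the Lipschitz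
        bound applies.\<close>
      have "k (of_real r * z) t - k (z / of_real r) t - - \<i> * (v t * M z t * of_real (?P t))
          = k (of_real r * z) t - k (z / of_real r) t - v t * M z t * (of_real (sin t) * (1 / (2 * \<zeta> t) - 1 / (2 * cnj (\<zeta> t))))"
        unfolding P by (simp add: mult_ac)
      also have "\<dots> = v t * of_real (sin t) * ((M (of_real r * z) t - M z t) / (2 * \<zeta> t) - (M (z / of_real r) t - M z t) / (2 * cnj (\<zeta> t)))"
      proof -
        have "a * A / x - a * B / y - v t * m * (of_real (sin t) * (1 / x - 1 / y)) = a * ((A - m) / x - (B - m) / y)"
          if "a = v t * of_real (sin t)" for A B m x y a
          unfolding that by (simp add: divide_inverse algebra_simps)
        then show ?thesis unfolding k1 k2 by blast
      qed
      finally have k: "k (of_real r * z) t - k (z / of_real r) t - - \<i> * (v t * M z t * of_real (?P t))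
          = v t * of_real (sin t) * ((M (of_real r * z) t - M z t) / (2 * \<zeta> t) - (M (z / of_real r) t - M z t) / (2 * cnj (\<zeta> t)))" .
      have "norm (k (of_real r * z) t - k (z / of_real r) t - - \<i> * (v t * M z t * of_real (?P t)))
          \<le> B * sin t * (L * (r - 1) / (2 * D) + L * (r - 1) / (2 * D))"
      proof -
        have "norm (M (of_real r * z) t - M z t) \<le> L * (r - 1)"
          using L(4)[OF w1(1) t] w1(2) by simp
        moreover have "norm (M (z / of_real r) t - M z t) \<le> L * (r - 1)"
          using L(4)[OF w2(1) t] mult_left_mono[OF w2(2) L(2)] by linarith
        ultimately have "norm ((M (of_real r * z) t - M z t) / (2 * \<zeta> t) - (M (z / of_real r) t - M z t) / (2 * cnj (\<zeta> t)))
            \<le> L * (r - 1) / (2 * D) + L * (r - 1) / (2 * D)"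
          using D by (intro order_trans[OF norm_triangle_ineq4] add_mono)
            (simp_all add: norm_divide norm_mult D_def divide_right_mono)
        moreover have "norm (v t * of_real (sin t)) \<le> B * sin t"
          using B(2)[OF t] st by (simp add: norm_mult mult_right_mono)
        ultimately show ?thesis
          using B(1) st unfolding k norm_mult[of "v t * of_real (sin t)"] by (intro mult_mono) auto
      qed
      also have "\<dots> = B * L * (r - 1) * (sin t / D)"
        by simp
      also have "\<dots> \<le> B * L * (2 * \<eta> r / sin \<theta>) * (sin t / D)"
      proof -
        \<comment> \<open>The right-hand side is \<open>r - 1 / r\<close>; this converts the
          distance to the circle into a multiple of \<open>\<eta>\<close>.\<close>
        have "r - 1 \<le> 2 * \<eta> r / sin \<theta>" using sin\<theta> r by (simp add: \<eta>_def field_simps)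
        then show ?thesis using B L(2) st D by (intro mult_right_mono mult_left_mono) auto
      qed
      also have "\<dots> = B * L / sin \<theta> * (2 * (\<eta> r * sin t / D))"
        by simp
      also have "\<dots> \<le> B * L / sin \<theta> * (sqrt (\<eta> r) * (1 + ?P t))"
      proof -
        define s where "s = sqrt (\<eta> r)"
        have s: "0 < s" "\<eta> r = s\<^sup>2" using \<eta>0 by (auto simp: s_def)
        have "2 * (s\<^sup>2 / D) \<le> s * (1 + s\<^sup>2 / D\<^sup>2)"
        proof -
          have "2 * s * D \<le> s\<^sup>2 + D\<^sup>2" by (rule sum_squares_bound)
          then have "s * (2 * s * D) \<le> s * (s\<^sup>2 + D\<^sup>2)" using s by simp
          then show ?thesis using D(1) by (simp add: field_simps power2_eq_square)
        qed
        then have "sin t * (2 * (s\<^sup>2 / D)) \<le> sin t * (s * (1 + s\<^sup>2 / D\<^sup>2))"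
          using st by (intro mult_left_mono)
        also have "\<dots> = s * (sin t + ?P t)"
          using \<zeta>n[of t] by (simp add: poisson_sin_def D_def s(2) algebra_simps)
        also have "\<dots> \<le> s * (1 + ?P t)" using s st by simp
        finally have "2 * (\<eta> r * sin t / D) \<le> s * (1 + ?P t)" by (simp add: s(2) mult_ac)
        then show ?thesis unfolding s_def using B L sin\<theta> by (intro mult_left_mono) auto
      qed
      finally show "norm (k (of_real r * z) t - k (z / of_real r) t - - \<i> * (v t * M z t * of_real (?P t)))
          \<le> B * L / sin \<theta> * (sqrt (\<eta> r) * (1 + ?P t))" .
    qed
    also have "\<dots> = B * L / sin \<theta> * (sqrt (\<eta> r) * (pi + integral {0..pi} ?P))"
    proof -
      have "?P integrable_on {0..pi}"
        using poisson_sin_has_integral[OF \<eta>0, of "\<xi> r"] by blast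
      then have "integral {0..pi} (\<lambda>t. 1 + ?P t) = pi + integral {0..pi} ?P"
        by (subst integral_add) auto
      then show ?thesis by simp
    qed
    also have "\<dots> \<le> B * L / sin \<theta> * (sqrt (\<eta> r) * (2 * pi))"
      using poisson_sin_integral_le[OF \<eta>0, of "\<xi> r"] B L sin\<theta> \<eta>0 by (intro mult_left_mono) auto
    finally show ?thesis .
  qed
  have "((\<lambda>r. B * L / sin \<theta> * (sqrt (\<eta> r) * (2 * pi))) \<longlongrightarrow> B * L / sin \<theta> * (sqrt 0 * (2 * pi))) (at_right 1)"
    by (rule tendsto_mult_left[OF tendsto_mult_right[OF tendsto_real_sqrt[OF \<eta>_lim]]])
  then have lim0: "((\<lambda>r. B * L / sin \<theta> * (sqrt (\<eta> r) * (2 * pi))) \<longlongrightarrow> 0) (at_right 1)"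
    by simp
  have "eventually (\<lambda>r. r < 1 + \<delta>) (at_right 1)"
    by (rule order_tendstoD(2)[OF tendsto_ident_at]) (use L(1) in simp)
  then have ev: "eventually (\<lambda>r. norm (G r - - \<i> * N r) \<le> B * L / sin \<theta> * (sqrt (\<eta> r) * (2 * pi))) (at_right 1)"
    by (rule eventually_elim2[OF r1]) (rule bound)
  have "((\<lambda>r. (G r - - \<i> * N r) + - \<i> * N r) \<longlongrightarrow> 0 + - \<i> * (of_real pi * (v \<theta> * M z \<theta>))) (at_right 1)"
    by (rule tendsto_add[OF Lim_null_comparison[OF ev lim0] main])
  then show ?thesis
    unfolding G_def z_def diff_add_cancel add_0_left mult.assoc .
qed

section \<open>The kernel of \<open>\<K>\<^sub>a\<^sub>,\<^sub>c\<close> and its semigroup property\<close>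

text \<open>At \<open>t = q powr (a / 2)\<close> this is the factor \<open>h\<close> in front of the
  integral, at \<open>t = 1\<close> the factor \<open>h\<close> with index \<open>c\<close> in the
  denominator. Both parameters depend on \<open>c / t\<close> alone.\<close>

definition K_prefactor :: "real \<Rightarrow> complex \<Rightarrow> real \<Rightarrow> complex \<Rightarrow> complex" where
  "K_prefactor q c t z = qth q (- c * of_real (q / t)) z * qth q (- of_real t / c) z"

definition K_denom :: "real \<Rightarrow> real \<Rightarrow> complex \<Rightarrow> real \<Rightarrow> complex" where
  "K_denom q t z \<phi> = qth q (of_real t * z) (cis \<phi>) * qth q (of_real t / z) (cis \<phi>)"

text \<open>\<open>w_H(cos \<phi>) sin \<phi>\<close> after cancelling \<open>sin \<phi>\<close>
  against the square root, which makes it continuous at the endpoints \<open>0\<close> and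
  \<open>pi\<close>.\<close>

definition hermite_density :: "real \<Rightarrow> real \<Rightarrow> complex" where
  "hermite_density q \<phi> = qpoch_inf (of_real q) q / of_real (2 * pi) * qth q 1 ((cis \<phi>)\<^sup>2)"

definition K_density :: "real \<Rightarrow> complex \<Rightarrow> (real \<Rightarrow> complex) \<Rightarrow> real \<Rightarrow> complex" where
  "K_density q c f \<phi> = hermite_density q \<phi> * f (cos \<phi>) / K_prefactor q c 1 (cis \<phi>)"

text \<open>Up to a constant, \<open>K_ext q c f t\<close> with \<open>t = q powr (a / 2)\<close> is the analytic extension of \<open>\<K>\<^sub>a\<^sub>,\<^sub>c f\<close>
  to the annulus \<open>t < |z| < 1/t\<close>.\<close>

definition K_ext :: "real \<Rightarrow> complex \<Rightarrow> (real \<Rightarrow> complex) \<Rightarrow> real \<Rightarrow> complex \<Rightarrow> complex" where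
  "K_ext q c f t z = K_prefactor q c t z
     * integral {0..pi} (\<lambda>\<phi>. qpoch_inf (of_real (t\<^sup>2)) q * K_density q c f \<phi> / K_denom q t z \<phi>)"

lemma K_prefactor_inverse: "K_prefactor q c t (1 / z) = K_prefactor q c t z"
  by (simp add: K_prefactor_def qth_inverse)

lemma K_denom_inverse: "K_denom q t (1 / z) \<phi> = K_denom q t z \<phi>"
  by (simp add: K_denom_def mult.commute)

lemma K_ext_inverse: "K_ext q c f t (1 / z) = K_ext q c f t z"
  unfolding K_ext_def K_prefactor_inverse K_denom_inverse ..

lemma K_ext_cmult: "K_ext q c (\<lambda>x. k * f x) t z = k * K_ext q c f t z"
proof -
  have "qpoch_inf (of_real (t\<^sup>2)) q * K_density q c (\<lambda>x. k * f x) \<phi> / K_denom q t z \<phi>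
      = k * (qpoch_inf (of_real (t\<^sup>2)) q * K_density q c f \<phi> / K_denom q t z \<phi>)" for \<phi>
    by (simp add: K_density_def)
  then show ?thesis unfolding K_ext_def by (simp only: integral_mult_right mult_ac)
qed

lemma qh_eq_qth: "qh q x [a, b] = qth q a (cis (arccos x)) * qth q b (cis (arccos x))"
proof -
  have "qpoch_inf (a * cis (- t)) q = qpoch_inf (a / cis t) q" for a t
    by (metis cis_inverse divide_inverse)
  then show ?thesis by (simp add: qh_def qth_def)
qed

definition K_annulus :: "real \<Rightarrow> complex set" where
  "K_annulus t = {z. t < norm z} \<inter> {z. t * norm z < 1}"

lemma open_K_annulus: "open (K_annulus t)"
  unfolding K_annulus_def by (intro open_Int open_Collect_less continuous_intros)

context
  fixes q :: real
  assumes q: "0 < q" "q < 1"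
begin

lemma wH_mult_sin:
  assumes "\<phi> \<in> {0..pi}"
  shows "wH q (cos \<phi>) * of_real (sin \<phi>) = hermite_density q \<phi>"
proof -
  have ac: "arccos (cos \<phi>) = \<phi>" using assms by (simp add: arccos_cos)
  have s: "sqrt (1 - (cos \<phi>)\<^sup>2) = sin \<phi>"
    using assms sin_ge_zero[of \<phi>] by (simp add: sin_squared_eq[symmetric])
  have c2: "cis (2 * \<phi>) = (cis \<phi>)\<^sup>2" "cis (- 2 * \<phi>) = 1 / (cis \<phi>)\<^sup>2"
    using Complex.DeMoivre[of \<phi> 2] cis_inverse[of "2 * \<phi>"] by (simp_all add: inverse_eq_divide)
  show ?thesis
  proof (cases "sin \<phi> = 0")
    case True
    with assms have "\<phi> = 0 \<or> \<phi> = pi"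
      using sin_gt_zero[of \<phi>] by force
    then have "(cis \<phi>)\<^sup>2 = 1" by auto
    then show ?thesis using True q by (simp add: hermite_density_def qth_def qpoch_1)
  next
    case False
    then show ?thesis
      unfolding wH_def hermite_density_def ac s c2 qth_def by (simp add: field_simps)
  qed
qed

lemma K_op_eq_K_ext:
  "K_op q a c f x = of_real (q powr (a * (a - 3) / 4)) * (of_real (1 - q) / (2 * c)) powr of_real a
     * K_ext q c f (q powr (a / 2)) (cis (arccos x))"
proof -
  define t where "t = q powr (a / 2)"
  have t: "0 < t" "t\<^sup>2 = q powr a" "q powr (1 - a / 2) = q / t"
    using q by (simp_all add: t_def powr_diff flip: powr_powr[of q "a / 2" 2, simplified] powr_numeral)
  have inv: "cis (- s) = 1 / cis s" for s by (metis cis_inverse inverse_eq_divide)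
  have "integral {0..pi} (\<lambda>\<phi>.
         wH q (cos \<phi>) * qpoch_inf (of_real (q powr a)) q * f (cos \<phi>) * of_real (sin \<phi>)
         / (qh q (cos \<phi>) [of_real t * cis (arccos x), of_real t * cis (- arccos x)]
            * qh q (cos \<phi>) [- 1 / c, - c * of_real q]))
      = integral {0..pi} (\<lambda>\<phi>. qpoch_inf (of_real (t\<^sup>2)) q * K_density q c f \<phi> / K_denom q t (cis (arccos x)) \<phi>)"
  proof (rule integral_cong)
    fix \<phi> assume \<phi>: "\<phi> \<in> {0..pi}"
    then have ac: "arccos (cos \<phi>) = \<phi>" by (simp add: arccos_cos)
    show "wH q (cos \<phi>) * qpoch_inf (of_real (q powr a)) q * f (cos \<phi>) * of_real (sin \<phi>)
         / (qh q (cos \<phi>) [of_real t * cis (arccos x), of_real t * cis (- arccos x)]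
            * qh q (cos \<phi>) [- 1 / c, - c * of_real q])
       = qpoch_inf (of_real (t\<^sup>2)) q * K_density q c f \<phi> / K_denom q t (cis (arccos x)) \<phi>"
      unfolding qh_eq_qth ac K_density_def wH_mult_sin[OF \<phi>, symmetric] K_denom_def K_prefactor_def t(2) inv
      by (simp add: mult_ac)
  qed
  then show ?thesis
    unfolding K_op_def K_ext_def t(3) qh_eq_qth by (fold t_def) (simp add: K_prefactor_def)
qed

text \<open>The form \<open>c = d / of_real t\<close> serves both indices: \<open>t = 1\<close>
  concerns the denominator of an operator with index \<open>c\<close>, general \<open>t\<close> the
  prefactor that has to cancel in a composition. Angles outside \<open>{0..pi}\<close> reduce to it
  by inversion.\<close>

lemma admissible_K_prefactor:
  assumes "admissible q c" "t > 0" "c = d / of_real t"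
  shows "d \<noteq> 0" "K_prefactor q d t (cis \<phi>) \<noteq> 0"
proof -
  show "d \<noteq> 0" using assms by (auto simp: admissible_def)
  have "K_prefactor q d t (cis \<phi>) \<noteq> 0" if "\<phi> \<in> {0..pi}" for \<phi>
  proof -
    have "qh q (cos \<phi>) [- 1 / c, - c * of_real q] \<noteq> 0"
      using assms(1) that by (simp add: admissible_def)
    then show ?thesis
      using that assms(2) unfolding qh_eq_qth by (simp add: arccos_cos K_prefactor_def assms(3))
  qed
  moreover have "\<exists>\<psi>\<in>{0..pi}. cis \<phi> = cis \<psi> \<or> cis \<phi> = 1 / cis \<psi>"
  proof -
    let ?\<psi> = "arccos (cos \<phi>)"
    have "cos ?\<psi> = cos \<phi>" by simp
    moreover have "sin ?\<psi> = \<bar>sin \<phi>\<bar>" using sin_arccos_abs[of "cos \<phi>"] by (simp add: sin_squared_eq[symmetric])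
    ultimately have "cis \<phi> = cis ?\<psi> \<or> cis \<phi> = cis (- ?\<psi>)"
      by (auto simp: complex_eq_iff abs_if)
    then have "cis \<phi> = cis ?\<psi> \<or> cis \<phi> = 1 / cis ?\<psi>"
      by (metis cis_inverse inverse_eq_divide)
    then show ?thesis using arccos_lbound[of "cos \<phi>"] arccos_ubound[of "cos \<phi>"] by force
  qed
  ultimately show "K_prefactor q d t (cis \<phi>) \<noteq> 0"
    using K_prefactor_inverse by metis
qed

lemma K_denom_nonzero:
  assumes "0 < t" "t < norm z" "t * norm z < 1"
  shows "K_denom q t z \<phi> \<noteq> 0"
proof -
  have "z \<noteq> 0" using assms by auto
  then have "norm (of_real t * z) < 1" "norm (of_real t / z) < 1"
    using assms by (simp_all add: norm_mult norm_divide divide_simps)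
  then show ?thesis by (simp add: K_denom_def qth_nonzero_circle[OF q])
qed

lemma K_denom_continuous [continuous_intros]:
  assumes "continuous_on S g" "continuous_on S h" "\<And>x. x \<in> S \<Longrightarrow> g x \<noteq> 0"
  shows "continuous_on S (\<lambda>x. K_denom q t (g x) (h x))"
  unfolding K_denom_def using assms by (intro continuous_intros q) auto

lemma K_prefactor_holomorphic [holomorphic_intros]:
  assumes "g holomorphic_on S" "\<And>x. x \<in> S \<Longrightarrow> g x \<noteq> 0"
  shows "(\<lambda>x. K_prefactor q c t (g x)) holomorphic_on S"
  unfolding K_prefactor_def using assms by (intro holomorphic_intros q) auto

lemma K_prefactor_continuous [continuous_intros]:
  assumes "continuous_on S g" "\<And>x. x \<in> S \<Longrightarrow> g x \<noteq> 0"
  shows "continuous_on S (\<lambda>x. K_prefactor q c t (g x))"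
  unfolding K_prefactor_def using assms by (intro continuous_intros q) auto

lemma hermite_density_continuous [continuous_intros]: "continuous_on S (hermite_density q)"
  unfolding hermite_density_def by (intro continuous_intros q) auto

lemma K_density_continuous:
  assumes "admissible q c" "continuous_on {-1..1} f"
  shows "continuous_on {0..pi} (K_density q c f)"
  unfolding K_density_def using admissible_K_prefactor(2)[OF assms(1), of 1 c]
  by (intro continuous_intros continuous_on_compose2[OF assms(2)] q) auto

lemma K_kernel_continuous:
  assumes "admissible q c" "continuous_on {-1..1} f" "0 < t"
  shows "continuous_on (K_annulus t \<times> {0..pi})
    (\<lambda>(z, \<phi>). qpoch_inf (of_real (t\<^sup>2)) q * K_density q c f \<phi> / K_denom q t z \<phi>)"
  unfolding case_prod_unfold
  using assms(3) K_denom_nonzero[OF assms(3)]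
  by (intro continuous_intros continuous_on_compose2[OF K_density_continuous[OF assms(1,2)]])
     (auto simp: K_annulus_def)

lemma K_ext_holomorphic:
  assumes "admissible q c" "continuous_on {-1..1} f" "0 < t"
  shows "K_ext q c f t holomorphic_on K_annulus t"
proof -
  have nz: "z \<noteq> 0" "K_denom q t z \<phi> \<noteq> 0" if "z \<in> K_annulus t" for z \<phi>
    using that assms(3) K_denom_nonzero[OF assms(3)] by (auto simp: K_annulus_def)
  have "(\<lambda>z. integral {0..pi} (\<lambda>\<phi>. qpoch_inf (of_real (t\<^sup>2)) q * K_density q c f \<phi> / K_denom q t z \<phi>))
      holomorphic_on K_annulus t"
  proof (rule holomorphic_on_integral[OF open_K_annulus K_kernel_continuous[OF assms]])
    fix \<phi> assume "\<phi> \<in> {0..pi}"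
    show "(\<lambda>z. qpoch_inf (of_real (t\<^sup>2)) q * K_density q c f \<phi> / K_denom q t z \<phi>) holomorphic_on K_annulus t"
      using nz unfolding K_denom_def by (intro holomorphic_intros q) auto
  qed
  then show ?thesis
    unfolding K_ext_def using nz by (intro holomorphic_intros) auto
qed

text \<open>The inner integral is an Askey--Wilson integral with parameters \<open>s z, s/z, t e\<^sup>i\<^sup>\<psi>, t e\<^sup>-\<^sup>i\<^sup>\<psi>\<close>.\<close>

lemma poisson_kernel_semigroup:
  assumes st: "0 < s" "s < 1" "0 < t" "t < 1" and z: "norm z = 1"
  shows "integral {0..pi} (\<lambda>\<phi>. hermite_density q \<phi> / (K_denom q s z \<phi> * K_denom q t (cis \<phi>) \<psi>))
      * (qpoch_inf (of_real (s\<^sup>2)) q * qpoch_inf (of_real (t\<^sup>2)) q)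
    = qpoch_inf (of_real ((s * t)\<^sup>2)) q / K_denom q (s * t) z \<psi>"
proof -
  define S T u where "S = complex_of_real s" and "T = complex_of_real t" and "u = cis \<psi>"
  have zu: "z \<noteq> 0" "u \<noteq> 0" "norm u = 1" using z by (auto simp: u_def)
  have nST: "norm S < 1" "norm T < 1" using st by (auto simp: S_def T_def)
  have lt: "norm (S * z) < 1" "norm (S / z) < 1" "norm (T * u) < 1" "norm (T / u) < 1"
    using z zu nST by (auto simp: norm_mult norm_divide)
  let ?I = "integral {0..pi} (\<lambda>\<phi>. aw_weight q (S * z) (S / z) (T * u) (T / u) (cis \<phi>))"
  define P where "P = qpoch_inf (of_real q) q"
  have P0: "P \<noteq> 0" unfolding P_def using q by (intro qpoch_nonzero) auto
  have "hermite_density q \<phi> / (K_denom q s z \<phi> * K_denom q t (cis \<phi>) \<psi>)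
      = P / of_real (2 * pi) * aw_weight q (S * z) (S / z) (T * u) (T / u) (cis \<phi>)" for \<phi>
  proof -
    \<comment> \<open>The kernel is symmetric in its two points, so both denominators can be read as
      functions of \<open>cis \<phi>\<close>.\<close>
    have "K_denom q t (cis \<phi>) \<psi> = qth q (T * u) (cis \<phi>) * qth q (T / u) (cis \<phi>)"
      by (simp add: K_denom_def qth_def T_def u_def mult_ac)
    then show ?thesis
      by (simp add: hermite_density_def aw_weight_def K_denom_def S_def P_def mult_ac)
  qed
  then have I: "integral {0..pi} (\<lambda>\<phi>. hermite_density q \<phi> / (K_denom q s z \<phi> * K_denom q t (cis \<phi>) \<psi>))
      = P / of_real (2 * pi) * ?I"
    by simp
  have AW: "?I * aw_factor q (S * z) (S / z) (T * u) (T / u) * P = of_real (2 * pi)"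
    unfolding P_def by (rule askey_wilson_integral[OF q lt])
  have e: "S * z * (S / z) = of_real (s\<^sup>2)" "T * u * (T / u) = of_real (t\<^sup>2)"
    "S * z * (S / z) * (T * u) * (T / u) = of_real ((s * t)\<^sup>2)"
    using zu by (simp_all add: S_def T_def power2_eq_square)
  have kd: "K_denom q (s * t) z \<psi> = qpoch_inf (S * z * (T * u)) q * qpoch_inf (S * z * (T / u)) q
      * qpoch_inf (S / z * (T * u)) q * qpoch_inf (S / z * (T / u)) q"
    by (simp add: K_denom_def qth_def S_def T_def u_def mult_ac)
  \<comment> \<open>Among the six pairwise products of the parameters two are \<open>s^2\<close> and
    \<open>t^2\<close>, and the other four rebuild the denominator at \<open>s * t\<close>.\<close>
  have fac: "aw_factor q (S * z) (S / z) (T * u) (T / u)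
      = qpoch_inf (of_real (s\<^sup>2)) q * qpoch_inf (of_real (t\<^sup>2)) q * K_denom q (s * t) z \<psi> / qpoch_inf (of_real ((s * t)\<^sup>2)) q"
    unfolding aw_factor_def e(3) unfolding e(1,2) kd by (simp only: mult_ac)
  have st2: "(s * t) < 1" "(s * t)\<^sup>2 < 1"
  proof -
    show "s * t < 1" using st mult_strict_mono[of s 1 t 1] by simp
    then show "(s * t)\<^sup>2 < 1" using st by (simp add: abs_square_less_1)
  qed
  have "qpoch_inf (of_real ((s * t)\<^sup>2)) q \<noteq> 0"
    using st2 by (intro qpoch_nonzero q) (simp add: norm_power norm_mult power_mult_distrib)
  moreover have "K_denom q (s * t) z \<psi> \<noteq> 0"
    using st2 st z by (intro K_denom_nonzero) auto
  ultimately show ?thesis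
    using AW P0 unfolding I fac by (simp add: field_simps)
qed

text \<open>The denominator of the outer density at index \<open>c / t\<close> is the prefactor of
  the inner operator. After this cancellation only Poisson kernels remain, and Fubini brings the
  \<open>\<phi>\<close>-integral inside, where \<open>poisson_kernel_semigroup\<close> evaluates
  it.\<close>

lemma K_ext_semigroup:
  assumes adm: "admissible q c" "admissible q (c / of_real t)" and f: "continuous_on {-1..1} f"
    and st: "0 < s" "s < 1" "0 < t" "t < 1" and z: "norm z = 1"
  shows "K_ext q (c / of_real t) (\<lambda>x. K_ext q c f t (cis (arccos x))) s z = K_ext q c f (s * t) z"
proof -
  let ?h = "\<lambda>x. K_ext q c f t (cis (arccos x))"
  define X where "X \<phi> \<psi> = qpoch_inf (of_real (s\<^sup>2)) q * qpoch_inf (of_real (t\<^sup>2)) q * hermite_density q \<phi> * K_density q c f \<psi>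
      / (K_denom q s z \<phi> * K_denom q t (cis \<phi>) \<psi>)" for \<phi> \<psi>
  have c0: "c \<noteq> 0" using adm by (auto simp: admissible_def)
  have dens: "K_density q (c / of_real t) ?h \<phi>
      = hermite_density q \<phi> * integral {0..pi} (\<lambda>\<psi>. qpoch_inf (of_real (t\<^sup>2)) q * K_density q c f \<psi> / K_denom q t (cis \<phi>) \<psi>)"
    if "\<phi> \<in> {0..pi}" for \<phi>
  proof -
    have "K_prefactor q (c / of_real t) 1 (cis \<phi>) = K_prefactor q c t (cis \<phi>)"
      by (simp add: K_prefactor_def)
    then show ?thesis
      using that admissible_K_prefactor(2)[OF adm(2) st(3) refl, of \<phi>]
      by (simp add: K_density_def arccos_cos K_ext_def)
  qed
  have "integral {0..pi} (\<lambda>\<phi>. qpoch_inf (of_real (s\<^sup>2)) q * K_density q (c / of_real t) ?h \<phi> / K_denom q s z \<phi>)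
      = integral {0..pi} (\<lambda>\<phi>. integral {0..pi} (X \<phi>))"
  proof (rule integral_cong)
    fix \<phi> assume "\<phi> \<in> {0..pi}"
    have "integral {0..pi} (X \<phi>) = integral {0..pi} (\<lambda>\<psi>. (qpoch_inf (of_real (s\<^sup>2)) q * hermite_density q \<phi> / K_denom q s z \<phi>)
        * (qpoch_inf (of_real (t\<^sup>2)) q * K_density q c f \<psi> / K_denom q t (cis \<phi>) \<psi>))"
      by (rule integral_cong) (simp add: X_def)
    also have "\<dots> = qpoch_inf (of_real (s\<^sup>2)) q * K_density q (c / of_real t) ?h \<phi> / K_denom q s z \<phi>"
      unfolding dens[OF \<open>\<phi> \<in> {0..pi}\<close>] integral_mult_right by simp
    finally show "qpoch_inf (of_real (s\<^sup>2)) q * K_density q (c / of_real t) ?h \<phi> / K_denom q s z \<phi> = integral {0..pi} (X \<phi>)" ..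
  qed
  also have "\<dots> = integral {0..pi} (\<lambda>\<psi>. integral {0..pi} (\<lambda>\<phi>. X \<phi> \<psi>))"
  proof -
    have "K_denom q s z \<phi> \<noteq> 0" "K_denom q t (cis \<phi>) \<psi> \<noteq> 0" for \<phi> \<psi>
      using st z by (simp_all add: K_denom_nonzero)
    moreover have "z \<noteq> 0" using z by auto
    ultimately have "continuous_on (cbox (0, 0) (pi, pi)) (\<lambda>(\<phi>, \<psi>). X \<phi> \<psi>)"
      unfolding X_def case_prod_unfold cbox_Pair_eq box_real
      by (intro continuous_intros continuous_on_compose2[OF K_density_continuous[OF adm(1) f]]
          continuous_on_compose2[OF hermite_density_continuous[of UNIV]]) auto
    from integral_swap_continuous[OF this] show ?thesis by simp
  qed
  also have "\<dots> = integral {0..pi} (\<lambda>\<psi>. qpoch_inf (of_real ((s * t)\<^sup>2)) q * K_density q c f \<psi> / K_denom q (s * t) z \<psi>)"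
  proof (rule integral_cong)
    fix \<psi>
    have "integral {0..pi} (\<lambda>\<phi>. X \<phi> \<psi>) = integral {0..pi} (\<lambda>\<phi>.
        (qpoch_inf (of_real (s\<^sup>2)) q * qpoch_inf (of_real (t\<^sup>2)) q * K_density q c f \<psi>)
        * (hermite_density q \<phi> / (K_denom q s z \<phi> * K_denom q t (cis \<phi>) \<psi>)))"
      by (rule integral_cong) (simp add: X_def)
    also have "\<dots> = K_density q c f \<psi> * (integral {0..pi} (\<lambda>\<phi>. hermite_density q \<phi> / (K_denom q s z \<phi> * K_denom q t (cis \<phi>) \<psi>))
      * (qpoch_inf (of_real (s\<^sup>2)) q * qpoch_inf (of_real (t\<^sup>2)) q))"
      unfolding integral_mult_right by (simp only: mult_ac)
    also have "\<dots> = qpoch_inf (of_real ((s * t)\<^sup>2)) q * K_density q c f \<psi> / K_denom q (s * t) z \<psi>"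
      unfolding poisson_kernel_semigroup[OF st z] by simp
    finally show "integral {0..pi} (\<lambda>\<phi>. X \<phi> \<psi>) = qpoch_inf (of_real ((s * t)\<^sup>2)) q * K_density q c f \<psi> / K_denom q (s * t) z \<psi>" .
  qed
  finally have "integral {0..pi} (\<lambda>\<phi>. qpoch_inf (of_real (s\<^sup>2)) q * K_density q (c / of_real t) ?h \<phi> / K_denom q s z \<phi>)
      = integral {0..pi} (\<lambda>\<psi>. qpoch_inf (of_real ((s * t)\<^sup>2)) q * K_density q c f \<psi> / K_denom q (s * t) z \<psi>)" .
  moreover have "K_prefactor q (c / of_real t) s z = K_prefactor q c (s * t) z"
    by (simp add: K_prefactor_def mult_ac)
  ultimately show ?thesis unfolding K_ext_def[of _ _ _ s] K_ext_def[of _ _ _ "s * t"] by simp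
qed

end

section \<open>The action of \<open>\<D>\<^sub>q\<close> on the kernel\<close>

lemma imaginary_unit_islimpt_semicircle: "\<i> islimpt cis ` {0<..<pi}"
proof (rule connected_imp_perfect)
  show "connected (cis ` {0<..<pi})"
    by (intro connected_continuous_image continuous_intros) auto
  show "\<i> \<in> cis ` {0<..<pi}"
    by (rule image_eqI[of _ _ "pi / 2"]) (auto simp: complex_eq_iff)
  have "cis (pi / 3) \<in> cis ` {0<..<pi}" "cis (pi / 3) \<noteq> \<i>"
    by (auto simp: complex_eq_iff cos_60)
  then show "cis ` {0<..<pi} \<noteq> {a}" for a
    using \<open>\<i> \<in> cis ` {0<..<pi}\<close> by (metis singletonD)
qed

lemma cis_arccos_minus_inverse:
  assumes "x \<in> {-1<..<1}"
  shows "cis (arccos x) - 1 / cis (arccos x) = 2 * \<i> * of_real (sin (arccos x))"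
    "sin (arccos x) > 0"
proof -
  have "1 / cis (arccos x) = cis (- arccos x)" by (metis cis_inverse inverse_eq_divide)
  then show "cis (arccos x) - 1 / cis (arccos x) = 2 * \<i> * of_real (sin (arccos x))"
    by (simp add: complex_eq_iff)
  show "sin (arccos x) > 0"
    using assms arccos_lt_bounded[of x] by (intro sin_gt_zero) auto
qed

context
  fixes q :: real
  assumes q: "0 < q" "q < 1"
begin

lemma sqrt_q: "0 < sqrt q" "sqrt q < 1" "sqrt q < 1 / sqrt q" "1 < 1 / sqrt q"
    "complex_of_real (sqrt q) * of_real (sqrt q) = of_real q" "complex_of_real (sqrt q) \<noteq> 0"
proof -
  show "0 < sqrt q" "sqrt q < 1" "complex_of_real (sqrt q) \<noteq> 0" using q by auto
  then show "1 < 1 / sqrt q" by simp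
  with \<open>sqrt q < 1\<close> show "sqrt q < 1 / sqrt q" by linarith
  show "complex_of_real (sqrt q) * of_real (sqrt q) = of_real q" using q by (simp flip: of_real_mult)
qed

text \<open>Identity theorem on the annulus, with accumulation on the open upper semicircle, where
  \<open>F\<close> and \<open>G\<close> are both tied to \<open>h\<close>.\<close>

lemma aw_extension_unique:
  assumes F: "aw_extension q h F"
    and G: "G holomorphic_on {z. sqrt q < norm z \<and> norm z < 1 / sqrt q}"
    and hG: "\<And>x. x \<in> {-1<..<1} \<Longrightarrow> h x = G (cis (arccos x))"
    and w: "sqrt q < norm w" "norm w < 1 / sqrt q"
  shows "F w = G w"
proof -
  let ?S = "{z :: complex. sqrt q < norm z \<and> norm z < 1 / sqrt q}"
  have "F w - G w = 0"
  proof (rule analytic_continuation[where S = ?S and U = "cis ` {0<..<pi}" and \<xi> = \<i> and f = "\<lambda>w. F w - G w"])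
    show "(\<lambda>w. F w - G w) holomorphic_on ?S"
      using F G by (intro holomorphic_intros) (auto simp: aw_extension_def)
    show "open ?S"
      by (intro open_Collect_conj open_Collect_less continuous_intros)
    show "connected ?S"
      using connected_annulus(1)[of "sqrt q" "0::complex" "1 / sqrt q"] by simp
    show "cis ` {0<..<pi} \<subseteq> ?S" using sqrt_q by auto
    show "\<i> \<in> ?S" using sqrt_q by simp
    show "\<i> islimpt cis ` {0<..<pi}" by (rule imaginary_unit_islimpt_semicircle)
    show "F z - G z = 0" if "z \<in> cis ` {0<..<pi}" for z
    proof -
      from that obtain \<theta> where \<theta>: "z = cis \<theta>" "0 < \<theta>" "\<theta> < pi" by auto
      then have "cos \<theta> \<in> {-1<..<1}"
        using cos_monotone_0_pi[of \<theta> pi] cos_monotone_0_pi[of 0 \<theta>] by auto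
      then have "F z = h (cos \<theta>)" "h (cos \<theta>) = G (cis (arccos (cos \<theta>)))"
        using F hG by (auto simp: aw_extension_def \<theta>)
      then show ?thesis using \<theta> by (simp add: arccos_cos)
    qed
  qed (use w in auto)
  then show ?thesis by simp
qed

text \<open>The values of the extension on the boundary of the annulus are obtained as radial limits.\<close>

lemma aw_op_tendsto:
  assumes dom: "h \<in> aw_dom q"
    and G: "G holomorphic_on {z. sqrt q < norm z \<and> norm z < 1 / sqrt q}"
    and hG: "\<And>x. x \<in> {-1<..<1} \<Longrightarrow> h x = G (cis (arccos x))"
    and x: "x \<in> {-1<..<1}" and z: "z = cis (arccos x)"
  shows "((\<lambda>r. G (of_real (sqrt q) * (of_real r * z)) - G (z / of_real r / of_real (sqrt q)))
      \<longlongrightarrow> aw_op q h x * (of_real (sqrt q - 1 / sqrt q) * (z - 1 / z) / 2)) (at_right 1)"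
proof -
  define F where "F = (SOME F. aw_extension q h F)"
  have F: "aw_extension q h F"
    using dom unfolding F_def aw_dom_def mem_Collect_eq by (rule someI_ex)
  let ?C = "{z :: complex. sqrt q \<le> norm z \<and> norm z \<le> 1 / sqrt q}"
  have Fc: "continuous_on ?C F" using F by (simp add: aw_extension_def)
  have nz: "norm z = 1" by (simp add: z)
  \<comment> \<open>For \<open>1 < r < 1 / q\<close> the points \<open>\<surd>q r z\<close> and
    \<open>z / (r \<surd>q)\<close> both lie in the open annulus.\<close>
  have "eventually (\<lambda>r::real. r < 1 / q) (at_right 1)"
    by (rule order_tendstoD(2)[OF tendsto_ident_at]) (use q in simp)
  moreover have "eventually (\<lambda>r::real. 1 < r) (at_right 1)"
    by (simp add: eventually_at_right_less)
  ultimately have ev: "eventually (\<lambda>r. 1 < r \<and> r < 1 / q) (at_right 1)"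
    by eventually_elim simp
  have rb: "sqrt q < sqrt q * r" "sqrt q * r < 1 / sqrt q" "sqrt q < 1 / r / sqrt q" "1 / r / sqrt q < 1 / sqrt q"
    if "1 < r \<and> r < 1 / q" for r
  proof -
    have "r * (sqrt q * sqrt q) < 1" using that q by (simp add: field_simps)
    then have rq: "sqrt q * r * sqrt q < 1" "sqrt q * sqrt q * r < 1" by (simp_all only: mult_ac)
    show "sqrt q < sqrt q * r" using that sqrt_q(1) by simp
    show "sqrt q * r < 1 / sqrt q"
      using rq(1) sqrt_q(1) by (simp only: pos_less_divide_eq)
    have "sqrt q * sqrt q < 1 / r"
      using rq(2) that by (simp add: pos_less_divide_eq)
    then show "sqrt q < 1 / r / sqrt q"
      using sqrt_q(1) by (simp only: pos_less_divide_eq)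
    show "1 / r / sqrt q < 1 / sqrt q"
      using sqrt_q(1) that by (intro divide_strict_right_mono) auto
  qed
  have norms: "norm (of_real (sqrt q) * (of_real r * z)) = sqrt q * r"
    "norm (z / of_real r / of_real (sqrt q)) = 1 / r / sqrt q" if "1 < r" for r
    using that nz sqrt_q(1) by (simp_all add: norm_mult norm_divide)
  have "((\<lambda>r. of_real (sqrt q) * (of_real r * z)) \<longlongrightarrow> of_real (sqrt q) * (of_real 1 * z)) (at_right 1)"
    by (intro tendsto_intros)
  then have "((\<lambda>r. F (of_real (sqrt q) * (of_real r * z))) \<longlongrightarrow> F (of_real (sqrt q) * z)) (at_right 1)"
  proof (intro continuous_on_tendsto_compose[OF Fc])
    show "eventually (\<lambda>r. of_real (sqrt q) * (of_real r * z) \<in> ?C) (at_right 1)"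
      using ev by eventually_elim (use norms rb in force)
  qed (use nz sqrt_q in \<open>auto simp: norm_mult\<close>)
  moreover have "((\<lambda>r. z / of_real r / of_real (sqrt q)) \<longlongrightarrow> z / of_real 1 / of_real (sqrt q)) (at_right 1)"
    by (intro tendsto_intros) (use sqrt_q in auto)
  then have "((\<lambda>r. F (z / of_real r / of_real (sqrt q))) \<longlongrightarrow> F (z / of_real (sqrt q))) (at_right 1)"
  proof (intro continuous_on_tendsto_compose[OF Fc])
    show "eventually (\<lambda>r. z / of_real r / of_real (sqrt q) \<in> ?C) (at_right 1)"
      using ev by eventually_elim (use norms rb in force)
  qed (use nz sqrt_q in \<open>auto simp: norm_divide\<close>)
  ultimately have "((\<lambda>r. F (of_real (sqrt q) * (of_real r * z)) - F (z / of_real r / of_real (sqrt q)))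
      \<longlongrightarrow> F (of_real (sqrt q) * z) - F (z / of_real (sqrt q))) (at_right 1)"
    by (rule tendsto_diff)
  moreover have "eventually (\<lambda>r. F (of_real (sqrt q) * (of_real r * z)) - F (z / of_real r / of_real (sqrt q))
      = G (of_real (sqrt q) * (of_real r * z)) - G (z / of_real r / of_real (sqrt q))) (at_right 1)"
    using ev
  proof eventually_elim
    case (elim r)
    have "F (of_real (sqrt q) * (of_real r * z)) = G (of_real (sqrt q) * (of_real r * z))"
      using rb[OF elim] norms[of r] elim by (intro aw_extension_unique[OF F G hG]) auto
    moreover have "F (z / of_real r / of_real (sqrt q)) = G (z / of_real r / of_real (sqrt q))"
      using rb[OF elim] norms[of r] elim by (intro aw_extension_unique[OF F G hG]) auto
    ultimately show ?case by simp
  qed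
  ultimately have "((\<lambda>r. G (of_real (sqrt q) * (of_real r * z)) - G (z / of_real r / of_real (sqrt q)))
      \<longlongrightarrow> F (of_real (sqrt q) * z) - F (z / of_real (sqrt q))) (at_right 1)"
    by (rule Lim_transform_eventually)
  moreover have "F (of_real (sqrt q) * z) - F (z / of_real (sqrt q))
      = aw_op q h x * (of_real (sqrt q - 1 / sqrt q) * (z - 1 / z) / 2)"
  proof -
    have "of_real (sqrt q - 1 / sqrt q) * (z - 1 / z) / 2 \<noteq> 0"
      using sqrt_q cis_arccos_minus_inverse[OF x] by (simp add: z flip: of_real_divide of_real_diff)
    then show ?thesis
      by (simp add: aw_op_def Let_def F_def z)
  qed
  ultimately show ?thesis by simp
qed

text \<open>Quasi-periodicity of theta type. Of the four \<open>q\<close>-products, one starts at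
  \<open>- y\<close> on the left and one step later on the right, another starts at
  \<open>- 1 / y\<close> on the right and one step later on the left; the quotient is
  \<open>(1 + y) / (1 + 1 / y) = y\<close>.\<close>

lemma K_prefactor_shift:
  assumes "c \<noteq> 0" "t > 0" "z \<noteq> 0"
  shows "K_prefactor q c t (of_real (sqrt q) * z)
    = c / (of_real (t / sqrt q) * z) * K_prefactor q c (t / sqrt q) z"
proof -
  define s T where "s = complex_of_real (sqrt q)" and "T = complex_of_real t"
  have nz: "s \<noteq> 0" "T \<noteq> 0" "c \<noteq> 0" "z \<noteq> 0" using sqrt_q assms by (auto simp: s_def T_def)
  have Q: "of_real q = s * s" using sqrt_q by (simp add: s_def)
  define y where "y = c * s / (T * z)"
  have y0: "y \<noteq> 0" using nz by (simp add: y_def)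
  have L: "K_prefactor q c t (s * z) = qpoch_inf (- c * (s * s) * s * z / T) q * qpoch_inf (- y) q
      * (qpoch_inf (- T * s * z / c) q * qpoch_inf (- T / (c * s * z)) q)"
    using nz by (simp add: K_prefactor_def qth_def y_def Q flip: T_def) (simp add: field_simps)
  have R: "K_prefactor q c (t / sqrt q) z = qpoch_inf (- c * (s * s) * s * z / T) q * qpoch_inf (- y * (s * s)) q
      * (qpoch_inf (- 1 / y) q * qpoch_inf (- T / (c * s * z)) q)"
    using nz by (simp add: K_prefactor_def qth_def y_def Q flip: T_def s_def) (simp add: field_simps)
  have 1: "qpoch_inf (- y) q = (1 + y) * qpoch_inf (- y * (s * s)) q"
    using qpoch_step[OF q, of "- y"] by (simp add: Q)
  have 2: "qpoch_inf (- 1 / y) q = (1 + 1 / y) * qpoch_inf (- T * s * z / c) q"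
  proof -
    have "- 1 / y * (s * s) = - T * s * z / c" using nz by (simp add: y_def field_simps)
    then show ?thesis using qpoch_step[OF q, of "- 1 / y"] by (simp add: Q)
  qed
  have 3: "c / (of_real (t / sqrt q) * z) = y"
    using nz by (simp add: y_def T_def s_def)
  show ?thesis
    unfolding s_def[symmetric] L 3 R 1 2 using y0 by (simp add: field_simps)
qed

text \<open>Passing from \<open>t', z\<close> to \<open>t, \<surd>q z\<close> multiplies
  \<open>t' * z\<close> by \<open>q\<close> and keeps \<open>t' / z\<close>.\<close>

lemma K_denom_shift:
  fixes t :: real
  defines "t' \<equiv> complex_of_real (t / sqrt q)"
  assumes "z \<noteq> 0"
  shows "K_denom q (t / sqrt q) z \<phi> = (1 - t' * z * cis \<phi>) * (1 - t' * z / cis \<phi>) * K_denom q t (of_real (sqrt q) * z) \<phi>"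
proof -
  have Q: "complex_of_real q = of_real (sqrt q) * of_real (sqrt q)" using sqrt_q by simp
  have 1: "t' * z * of_real q = of_real t * (of_real (sqrt q) * z)"
    using sqrt_q(6) unfolding Q t'_def by simp
  have 2: "of_real t / (of_real (sqrt q) * z) = t' / z"
    by (simp add: t'_def)
  show ?thesis
    unfolding K_denom_def 2 t'_def[symmetric] 1[symmetric] by (subst qth_step[OF q]) (rule mult.assoc)
qed

text \<open>By inversion both terms are values at \<open>\<surd>q w\<close>, with
  \<open>w = z\<close> and \<open>w = 1/z\<close>. Their kernels differ from the one at
  \<open>t' = t / \<surd>q\<close> by
  \<open>(1 - t' w u)(1 - t' w / u) / w = 1/w - t' (u + 1/u) + t'^2 w\<close> with
  \<open>u = cis \<phi>\<close>. In the difference the middle term drops out and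
  \<open>(1/z - z)(1 - t'^2)\<close> remains; the factor \<open>1 - t'^2\<close> completes
  \<open>(t^2;q)_inf\<close> to \<open>(t'^2;q)_inf\<close>.\<close>

lemma K_ext_shift:
  assumes adm: "admissible q c" and f: "continuous_on {-1..1} f"
    and t: "0 < t" "t < sqrt q" and z: "norm z = 1"
  shows "K_ext q c f t (of_real (sqrt q) * z) - K_ext q c f t (z / of_real (sqrt q))
    = c / of_real (t / sqrt q) * (1 / z - z) * K_ext q c f (t / sqrt q) z"
proof -
  define t' where "t' = t / sqrt q"
  have t': "0 < t'" "t' < 1" using t sqrt_q by (auto simp: t'_def)
  have c0: "c \<noteq> 0" using adm by (auto simp: admissible_def)
  have z0: "z \<noteq> 0" using z by auto
  define P where "P = qpoch_inf (of_real (t\<^sup>2)) q"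
  define A where "A = K_prefactor q c t' z"
  define k where "k \<phi> = K_density q c f \<phi> / K_denom q t' z \<phi>" for \<phi>
  have KD: "K_denom q t' w \<phi> \<noteq> 0" if "norm w = 1" for w \<phi>
    using t' that by (intro K_denom_nonzero[OF q]) auto
  have kc: "continuous_on {0..pi} k"
    unfolding k_def using K_density_continuous[OF q adm f] z0 KD[OF z] by (intro continuous_intros q) auto
  have val: "K_ext q c f t (of_real (sqrt q) * w) = integral {0..pi} (\<lambda>\<phi>. (c / of_real t' * A * P) *
      (k \<phi> * ((1 - of_real t' * w * cis \<phi>) * (1 - of_real t' * w / cis \<phi>) / w)))"
    if w: "w = z \<or> w = 1 / z" for w
  proof -
    have w1: "norm w = 1" "w \<noteq> 0" using w z by (auto simp: norm_divide)
    have A: "K_prefactor q c t' w = A" using w by (auto simp: A_def K_prefactor_inverse)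
    have inv: "K_density q c f \<phi> / K_denom q t (of_real (sqrt q) * w) \<phi>
        = k \<phi> * ((1 - of_real t' * w * cis \<phi>) * (1 - of_real t' * w / cis \<phi>))" for \<phi>
    proof -
      have "K_denom q t' z \<phi> = K_denom q t' w \<phi>" using w by (auto simp: K_denom_inverse)
      also have "K_denom q t' w \<phi> = (1 - of_real t' * w * cis \<phi>) * (1 - of_real t' * w / cis \<phi>) * K_denom q t (of_real (sqrt q) * w) \<phi>"
        unfolding t'_def by (rule K_denom_shift[OF w1(2)])
      finally show ?thesis
        using KD[OF z, of \<phi>] unfolding k_def by simp
    qed
    have "K_ext q c f t (of_real (sqrt q) * w) = integral {0..pi} (\<lambda>\<phi>. c / (of_real t' * w) * A * (P * (K_density q c f \<phi> / K_denom q t (of_real (sqrt q) * w) \<phi>)))"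
      unfolding K_ext_def integral_mult_right[where c = "c / (of_real t' * w) * A"] K_prefactor_shift[OF c0 t(1) w1(2)]
      by (simp only: P_def A times_divide_eq_right flip: t'_def)
    also have "\<dots> = integral {0..pi} (\<lambda>\<phi>. (c / of_real t' * A * P) *
      (k \<phi> * ((1 - of_real t' * w * cis \<phi>) * (1 - of_real t' * w / cis \<phi>) / w)))"
      unfolding inv by (rule integral_cong) simp
    finally show ?thesis .
  qed
  have int: "(\<lambda>\<phi>. (c / of_real t' * A * P) * (k \<phi> * ((1 - of_real t' * w * cis \<phi>) * (1 - of_real t' * w / cis \<phi>) / w))) integrable_on {0..pi}"
    if "w \<noteq> 0" for w
    by (intro integrable_continuous_interval continuous_intros kc) (use that in auto)
  have "z / of_real (sqrt q) = 1 / (of_real (sqrt q) * (1 / z))" by simp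
  then have "K_ext q c f t (z / of_real (sqrt q)) = K_ext q c f t (of_real (sqrt q) * (1 / z))"
    by (metis K_ext_inverse)
  then have "K_ext q c f t (of_real (sqrt q) * z) - K_ext q c f t (z / of_real (sqrt q))
      = K_ext q c f t (of_real (sqrt q) * z) - K_ext q c f t (of_real (sqrt q) * (1 / z))" by simp
  also have "\<dots> = integral {0..pi} (\<lambda>\<phi>. (c / of_real t' * A * P) * (k \<phi> * ((1 - of_real t' * z * cis \<phi>) * (1 - of_real t' * z / cis \<phi>) / z))
      - (c / of_real t' * A * P) * (k \<phi> * ((1 - of_real t' * (1/z) * cis \<phi>) * (1 - of_real t' * (1/z) / cis \<phi>) / (1/z))))"
    unfolding val[OF disjI1[OF refl]] val[OF disjI2[OF refl]]
    by (rule integral_diff[symmetric]; rule int) (use z0 in simp_all)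
  also have "\<dots> = integral {0..pi} (\<lambda>\<phi>. c / of_real t' * (1 / z - z) * A * (((1 - of_real (t'\<^sup>2)) * P) * k \<phi>))"
  proof (rule integral_cong)
    fix \<phi>
    have "(1 - of_real t' * z * u) * (1 - of_real t' * z / u) / z - (1 - of_real t' * (1/z) * u) * (1 - of_real t' * (1/z) / u) / (1/z)
        = (1 / z - z) * (1 - of_real (t'\<^sup>2))" if "u \<noteq> 0" for u
      using that z0 by (simp add: field_simps power2_eq_square)
    from this[OF cis_neq_zero, of \<phi>]
    show "(c / of_real t' * A * P) * (k \<phi> * ((1 - of_real t' * z * cis \<phi>) * (1 - of_real t' * z / cis \<phi>) / z))
      - (c / of_real t' * A * P) * (k \<phi> * ((1 - of_real t' * (1/z) * cis \<phi>) * (1 - of_real t' * (1/z) / cis \<phi>) / (1/z)))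
      = c / of_real t' * (1 / z - z) * A * (((1 - of_real (t'\<^sup>2)) * P) * k \<phi>)"
      unfolding right_diff_distrib[symmetric] by simp
  qed
  also have "(1 - of_real (t'\<^sup>2)) * P = qpoch_inf (of_real (t'\<^sup>2)) q"
  proof -
    have "of_real (t'\<^sup>2) * of_real q = (of_real (t\<^sup>2) :: complex)"
      using q by (simp add: t'_def power_divide flip: of_real_mult)
    then show ?thesis using qpoch_step[OF q, of "of_real (t'\<^sup>2)"] by (simp add: P_def)
  qed
  also have "integral {0..pi} (\<lambda>\<phi>. c / of_real t' * (1 / z - z) * A * (qpoch_inf (of_real (t'\<^sup>2)) q * k \<phi>))
      = c / of_real t' * (1 / z - z) * K_ext q c f t' z"
  proof -
    have K: "K_ext q c f t' z = A * integral {0..pi} (\<lambda>\<phi>. qpoch_inf (of_real (t'\<^sup>2)) q * k \<phi>)"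
      by (simp only: K_ext_def A_def k_def times_divide_eq_right)
    show ?thesis unfolding K integral_mult_right by (simp only: mult_ac)
  qed
  finally show ?thesis by (simp add: t'_def)
qed

end

context
  fixes q :: real
  assumes q: "0 < q" "q < 1"
begin

lemma K_ext_holomorphic_aw_annulus:
  assumes "admissible q c" "continuous_on {-1..1} f" "0 < t" "t \<le> sqrt q"
  shows "K_ext q c f t holomorphic_on {z. sqrt q < norm z \<and> norm z < 1 / sqrt q}"
proof (rule holomorphic_on_subset[OF K_ext_holomorphic[OF q assms(1-3)]], safe)
  fix z :: complex assume z: "sqrt q < norm z" "norm z < 1 / sqrt q"
  have "t * norm z \<le> sqrt q * norm z" using assms by (intro mult_right_mono) auto
  also have "\<dots> < 1" using z q by (simp add: field_simps)
  finally show "z \<in> K_annulus t" using z assms by (simp add: K_annulus_def)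
qed

lemma aw_op_value:
  assumes x: "x \<in> {-1<..<1}" and z: "z = cis (arccos x)"
    and eq: "aw_op q h x * (of_real (sqrt q - 1 / sqrt q) * (z - 1 / z) / 2) = (1 / z - z) * Y"
  shows "aw_op q h x = of_real (2 * sqrt q / (1 - q)) * Y"
proof -
  have nz: "z - 1 / z \<noteq> 0" using cis_arccos_minus_inverse[OF x] by (simp add: z)
  have s: "sqrt q - 1 / sqrt q = - (1 - q) / sqrt q" "sqrt q > 0"
    using q by (simp_all add: field_simps)
  have "(z - 1 / z) * (aw_op q h x * of_real (- (1 - q) / sqrt q) / 2) = (z - 1 / z) * (- Y)"
    using eq unfolding s(1) by (simp add: algebra_simps)
  then have "aw_op q h x * of_real (- (1 - q) / sqrt q) / 2 = - Y"
    by (rule iffD1[OF mult_left_cancel[OF nz]])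
  then have e: "aw_op q h x * of_real (1 - q) = 2 * of_real (sqrt q) * Y"
    using s(2) by (simp add: field_simps)
  have "complex_of_real (1 - q) \<noteq> 0" using q by (subst of_real_eq_0_iff) simp
  then have "aw_op q h x = 2 * of_real (sqrt q) * Y / of_real (1 - q)"
    by (rule iffD2[OF nonzero_eq_divide_eq e])
  then show ?thesis by simp
qed

text \<open>For \<open>t < \<surd>q\<close> the explicit extension is still continuous at the points
  \<open>\<surd>q z\<close> and \<open>z / \<surd>q\<close>, so the radial limits are values and
  \<open>K_ext_shift\<close> applies.\<close>

lemma aw_op_K_ext:
  assumes dom: "h \<in> aw_dom q" and adm: "admissible q c" and f: "continuous_on {-1..1} f"
    and t: "0 < t" "t < sqrt q"
    and h: "\<And>x. x \<in> {-1<..<1} \<Longrightarrow> h x = \<kappa> * K_ext q c f t (cis (arccos x))"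
    and x: "x \<in> {-1<..<1}"
  shows "aw_op q h x = \<kappa> * (2 * c * of_real (sqrt q / (1 - q))) / of_real (t / sqrt q) * K_ext q c f (t / sqrt q) (cis (arccos x))"
proof -
  define z where "z = cis (arccos x)"
  define G where "G w = \<kappa> * K_ext q c f t w" for w
  have nz: "norm z = 1" by (simp add: z_def)
  have G: "G holomorphic_on K_annulus t" "G holomorphic_on {z. sqrt q < norm z \<and> norm z < 1 / sqrt q}"
    unfolding G_def using K_ext_holomorphic[OF q adm f t(1)] K_ext_holomorphic_aw_annulus[OF adm f t(1)] t
    by (auto intro!: holomorphic_intros)
  have lim: "((\<lambda>r. G (of_real (sqrt q) * (of_real r * z)) - G (z / of_real r / of_real (sqrt q)))
      \<longlongrightarrow> aw_op q h x * (of_real (sqrt q - 1 / sqrt q) * (z - 1 / z) / 2)) (at_right 1)"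
    using h by (intro aw_op_tendsto[OF q dom G(2) _ x z_def]) (auto simp: G_def)
  have cont: "isCont G (of_real (sqrt q) * z)" "isCont G (z / of_real (sqrt q))"
  proof -
    have "t * sqrt q < 1" using t sqrt_q(2)[OF q] mult_strict_mono[of t 1 "sqrt q" 1] q by simp
    then have "of_real (sqrt q) * z \<in> K_annulus t"
      using t nz sqrt_q(1)[OF q] by (simp add: K_annulus_def norm_mult)
    moreover have "t < 1 / sqrt q" using t sqrt_q(3)[OF q] by linarith
    then have "z / of_real (sqrt q) \<in> K_annulus t"
      using t nz sqrt_q(1)[OF q] by (simp add: K_annulus_def norm_divide)
    ultimately show "isCont G (of_real (sqrt q) * z)" "isCont G (z / of_real (sqrt q))"
      using holomorphic_on_imp_continuous_on[OF G(1)] open_K_annulus by (auto simp: continuous_on_eq_continuous_at)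
  qed
  have arg1: "((\<lambda>r. of_real (sqrt q) * (of_real r * z)) \<longlongrightarrow> of_real (sqrt q) * z) (at_right 1)"
    using q by (auto intro!: tendsto_eq_intros)
  have arg2: "((\<lambda>r. z / of_real r / of_real (sqrt q)) \<longlongrightarrow> z / of_real (sqrt q)) (at_right 1)"
    using q by (auto intro!: tendsto_eq_intros)
  have "((\<lambda>r. G (of_real (sqrt q) * (of_real r * z)) - G (z / of_real r / of_real (sqrt q)))
      \<longlongrightarrow> G (of_real (sqrt q) * z) - G (z / of_real (sqrt q))) (at_right 1)"
    by (rule tendsto_diff[OF isCont_tendsto_compose[OF cont(1) arg1] isCont_tendsto_compose[OF cont(2) arg2]])
  from tendsto_unique[OF trivial_limit_at_right_real lim this]
  have "aw_op q h x * (of_real (sqrt q - 1 / sqrt q) * (z - 1 / z) / 2)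
      = \<kappa> * (K_ext q c f t (of_real (sqrt q) * z) - K_ext q c f t (z / of_real (sqrt q)))"
    by (simp add: G_def right_diff_distrib)
  also have "\<dots> = (1 / z - z) * (\<kappa> * (c / of_real (t / sqrt q)) * K_ext q c f (t / sqrt q) z)"
    unfolding K_ext_shift[OF q adm f t nz] by (simp only: mult_ac)
  finally have "aw_op q h x = of_real (2 * sqrt q / (1 - q)) * (\<kappa> * (c / of_real (t / sqrt q)) * K_ext q c f (t / sqrt q) z)"
    by (rule aw_op_value[OF x z_def])
  then show ?thesis by (simp add: z_def mult_ac)
qed

text \<open>One of the two sines in
  \<open>(1 - e^(2i\<phi>))(1 - e^(-2i\<phi>)) = 4 sin^2 \<phi>\<close> is set apart: it is the
  Jacobian that \<open>cauchy_kernel_jump\<close> expects.\<close>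

lemma hermite_density_sin:
  "hermite_density q \<phi> = qpoch_inf (of_real q) q / of_real (2 * pi) * (4 * of_real (sin \<phi>) * qth q (of_real q) ((cis \<phi>)\<^sup>2))
     * of_real (sin \<phi>)"
proof -
  have "1 / cis \<phi> = cis (- \<phi>)" by (metis cis_inverse inverse_eq_divide)
  then have "cis \<phi> - 1 / cis \<phi> = 2 * \<i> * of_real (sin \<phi>)"
    by (simp add: complex_eq_iff)
  moreover have "(1 - (cis \<phi>)\<^sup>2) * (1 - 1 / (cis \<phi>)\<^sup>2) = - (cis \<phi> - 1 / cis \<phi>)\<^sup>2"
    by (simp add: field_simps power2_eq_square)
  ultimately have "(1 - (cis \<phi>)\<^sup>2) * (1 - 1 / (cis \<phi>)\<^sup>2) = 4 * of_real (sin \<phi>) * of_real (sin \<phi>)"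
    by (simp add: power_mult_distrib power2_eq_square)
  moreover have "qth q 1 ((cis \<phi>)\<^sup>2) = (1 - (cis \<phi>)\<^sup>2) * (1 - 1 / (cis \<phi>)\<^sup>2) * qth q (of_real q) ((cis \<phi>)\<^sup>2)"
    by (subst qth_step[OF q]) simp
  ultimately show ?thesis
    by (simp add: hermite_density_def)
qed

text \<open>Here one parameter becomes \<open>1 / w\<close>, and its leading factors form the Cauchy
  denominator in the variable \<open>cos \<phi>\<close>. The remaining factor has no zeros for
  \<open>q < |w| < 1 / q\<close>, hence none near the unit circle.\<close>

lemma K_denom_critical:
  assumes "w \<noteq> 0"
  shows "K_denom q (sqrt q) (of_real (sqrt q) * w) \<phi> = (w + 1 / w - 2 * of_real (cos \<phi>)) / w * K_denom q q w \<phi>"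
proof -
  have 1: "of_real (sqrt q) * (of_real (sqrt q) * w) = of_real q * w"
    using sqrt_q(5)[OF q] by (metis mult.assoc)
  have 2: "of_real (sqrt q) / (of_real (sqrt q) * w) = 1 / w"
    using q by simp
  have 3: "1 / w * of_real q = of_real q / w" by simp
  have cs: "cis \<phi> + 1 / cis \<phi> = 2 * of_real (cos \<phi>)"
  proof -
    have "1 / cis \<phi> = cis (- \<phi>)" by (metis cis_inverse inverse_eq_divide)
    then show ?thesis by (simp add: complex_eq_iff)
  qed
  have "(1 - 1 / w * u) * (1 - 1 / w / u) = (w + 1 / w - (u + 1 / u)) / w" if "u \<noteq> 0" for u
    using that assms by (simp add: field_simps power2_eq_square)
  from this[OF cis_neq_zero, of \<phi>] show ?thesis
    unfolding K_denom_def 1 2 qth_step[OF q, of "1 / w"] 3 cs by simp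
qed

text \<open>At \<open>t = \<surd>q\<close> the poles of the kernel reach the boundary of the annulus, and \<open>\<D>\<^sub>q\<close> becomes the jump of a Cauchy integral.\<close>

lemma aw_op_K_ext_critical:
  assumes dom: "h \<in> aw_dom q" and adm: "admissible q c" and f: "continuous_on {-1..1} f"
    and h: "\<And>x. x \<in> {-1<..<1} \<Longrightarrow> h x = \<kappa> * K_ext q c f (sqrt q) (cis (arccos x))"
    and x: "x \<in> {-1<..<1}"
  shows "aw_op q h x = \<kappa> * (2 * c * of_real (sqrt q / (1 - q))) * f x"
proof -
  define \<theta> z where "\<theta> = arccos x" and "z = cis \<theta>"
  have \<theta>: "0 < \<theta>" "\<theta> < pi" "cos \<theta> = x"
    using x arccos_lt_bounded[of x] by (auto simp: \<theta>_def)
  have nz: "norm z = 1" "z \<noteq> 0" by (auto simp: z_def)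
  have c0: "c \<noteq> 0" using adm by (auto simp: admissible_def)
  define P where "P = qpoch_inf (of_real q) q"
  have P0: "P \<noteq> 0" unfolding P_def using q by (intro qpoch_nonzero) auto
  have hc: "K_prefactor q c 1 (cis \<phi>) \<noteq> 0" for \<phi>
    by (rule admissible_K_prefactor(2)[OF q adm]) auto
  define v where "v \<phi> = P / of_real (2 * pi) * (4 * of_real (sin \<phi>) * qth q (of_real q) ((cis \<phi>)\<^sup>2))
      * f (cos \<phi>) / K_prefactor q c 1 (cis \<phi>)" for \<phi>
  have v: "continuous_on {0..pi} v"
    unfolding v_def using hc by (intro continuous_intros q continuous_on_compose2[OF f]) auto
  have dens: "K_density q c f \<phi> = v \<phi> * of_real (sin \<phi>)" for \<phi>
    unfolding K_density_def hermite_density_sin v_def P_def by simp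
  \<comment> \<open>\<open>M\<close> collects what is holomorphic across the unit circle. The
    \<open>1 / w\<close> from \<open>K_prefactor_shift\<close> cancels the one in
    \<open>K_denom_critical\<close>, which makes \<open>k\<close> invariant under inversion.\<close>
  define M where "M w \<phi> = c * P * K_prefactor q c 1 w / K_denom q q w \<phi>" for w \<phi>
  define k where "k w \<phi> = v \<phi> * of_real (sin \<phi>) * M w \<phi> / (w + 1 / w - 2 * of_real (cos \<phi>))" for w \<phi>
  have k_inverse: "k (1 / w) \<phi> = k w \<phi>" for w \<phi>
    by (simp add: k_def M_def K_prefactor_inverse K_denom_inverse add.commute)
  have k_eq: "K_prefactor q c (sqrt q) (of_real (sqrt q) * w)
      * (qpoch_inf (of_real ((sqrt q)\<^sup>2)) q * K_density q c f \<phi> / K_denom q (sqrt q) (of_real (sqrt q) * w) \<phi>) = k w \<phi>"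
    if "w \<noteq> 0" for w \<phi>
  proof -
    have "K_prefactor q c (sqrt q) (of_real (sqrt q) * w) = c / w * K_prefactor q c 1 w"
      using K_prefactor_shift[OF q c0 _ that, of "sqrt q"] q by simp
    then show ?thesis
      unfolding K_denom_critical[OF that] dens k_def M_def using that q by (simp add: P_def mult_ac)
  qed
  have K_k: "K_ext q c f (sqrt q) (of_real (sqrt q) * w) = integral {0..pi} (k w)" if "w \<noteq> 0" for w
    unfolding K_ext_def integral_mult_right[symmetric] k_eq[OF that] ..
  have k_int: "k w integrable_on {0..pi}" if w: "1 < norm w" "norm w < 1 / q" for w
  proof -
    have w0: "w \<noteq> 0" using w by auto
    have "of_real (sqrt q) * w \<in> K_annulus (sqrt q)"
    proof -
      have "sqrt q * (sqrt q * norm w) = q * norm w"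
        using q by (simp flip: mult.assoc)
      also have "q * norm w < 1" using w q by (simp add: field_simps)
      finally show ?thesis using w q by (simp add: K_annulus_def norm_mult)
    qed
    from continuous_on_curried_subset[OF K_kernel_continuous[OF q adm f] this] q
    have "continuous_on {0..pi} (\<lambda>\<phi>. qpoch_inf (of_real ((sqrt q)\<^sup>2)) q * K_density q c f \<phi> / K_denom q (sqrt q) (of_real (sqrt q) * w) \<phi>)"
      by simp
    from continuous_on_mult_left[OF this, of "K_prefactor q c (sqrt q) (of_real (sqrt q) * w)"]
    show ?thesis unfolding k_eq[OF w0] by (rule integrable_continuous_interval)
  qed
  define W where "W = K_annulus q"
  have W: "open W" "cis \<theta> \<in> W" unfolding W_def using open_K_annulus q by (auto simp: K_annulus_def)
  have Wn: "w \<noteq> 0" "K_denom q q w \<phi> \<noteq> 0" if "w \<in> W" for w \<phi>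
    using that q K_denom_nonzero[OF q q(1)] by (auto simp: W_def K_annulus_def)
  have "((\<lambda>r. integral {0..pi} (\<lambda>t. k (of_real r * cis \<theta>) t - k (cis \<theta> / of_real r) t))
      \<longlongrightarrow> - \<i> * of_real pi * (v \<theta> * M (cis \<theta>) \<theta>)) (at_right 1)"
    unfolding k_def
  proof (rule cauchy_kernel_jump[OF v \<theta>(1,2) W])
    show "continuous_on (W \<times> {0..pi}) (\<lambda>(w, t). M w t)"
      unfolding M_def case_prod_unfold using Wn by (intro continuous_intros q) auto
    show "(\<lambda>w. M w t) holomorphic_on W" for t
      unfolding M_def K_denom_def using Wn by (intro holomorphic_intros q) (auto simp: K_denom_def)
  qed
  then have jump: "((\<lambda>r. \<kappa> * integral {0..pi} (\<lambda>t. k (of_real r * z) t - k (z / of_real r) t))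
      \<longlongrightarrow> \<kappa> * (- \<i> * of_real pi * (v \<theta> * M z \<theta>))) (at_right 1)"
    unfolding z_def by (rule tendsto_mult_left)
  define G where "G w = \<kappa> * K_ext q c f (sqrt q) w" for w
  have G: "G holomorphic_on {z. sqrt q < norm z \<and> norm z < 1 / sqrt q}"
    unfolding G_def using K_ext_holomorphic_aw_annulus[OF adm f, of "sqrt q"] q
    by (auto intro!: holomorphic_intros)
  have lim: "((\<lambda>r. G (of_real (sqrt q) * (of_real r * z)) - G (z / of_real r / of_real (sqrt q)))
      \<longlongrightarrow> aw_op q h x * (of_real (sqrt q - 1 / sqrt q) * (z - 1 / z) / 2)) (at_right 1)"
    using h by (intro aw_op_tendsto[OF q dom G _ x]) (auto simp: G_def z_def \<theta>_def)
  have "eventually (\<lambda>r::real. r < 1 / q) (at_right 1)"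
    by (rule order_tendstoD(2)[OF tendsto_ident_at]) (use q in simp)
  moreover have "eventually (\<lambda>r::real. 1 < r) (at_right 1)"
    by (simp add: eventually_at_right_less)
  ultimately have "eventually (\<lambda>r. G (of_real (sqrt q) * (of_real r * z)) - G (z / of_real r / of_real (sqrt q))
      = \<kappa> * integral {0..pi} (\<lambda>t. k (of_real r * z) t - k (z / of_real r) t)) (at_right 1)"
  proof eventually_elim
    case (elim r)
    define w where "w = of_real r * z"
    have w: "1 < norm w" "norm w < 1 / q" "w \<noteq> 0" using elim nz by (auto simp: w_def norm_mult)
    \<comment> \<open>The inner point \<open>z / r\<close> is traded for its inverse, which lies
      outside the unit circle, where \<open>k_int\<close> applies.\<close>
    define w' where "w' = of_real r * (1 / z)"
    have w': "1 < norm w'" "norm w' < 1 / q" "w' \<noteq> 0" using elim nz by (auto simp: w'_def norm_mult norm_divide)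
    have k': "k (z / of_real r) = k w'"
      using k_inverse[of w'] by (auto simp: w'_def)
    have "z / of_real r / of_real (sqrt q) = 1 / (of_real (sqrt q) * w')"
      by (simp add: w'_def)
    then have "K_ext q c f (sqrt q) (z / of_real r / of_real (sqrt q)) = integral {0..pi} (k w')"
      using K_k[OF w'(3)] by (simp only: K_ext_inverse)
    moreover have "K_ext q c f (sqrt q) (of_real (sqrt q) * w) = integral {0..pi} (k w)"
      by (rule K_k[OF w(3)])
    moreover have "integral {0..pi} (\<lambda>t. k w t - k w' t) = integral {0..pi} (k w) - integral {0..pi} (k w')"
      by (rule integral_diff[OF k_int[OF w(1,2)] k_int[OF w'(1,2)]])
    ultimately show ?case
      unfolding G_def w_def[symmetric] k' by (simp add: right_diff_distrib)
  qed
  from Lim_transform_eventually[OF lim this]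
  have "aw_op q h x * (of_real (sqrt q - 1 / sqrt q) * (z - 1 / z) / 2) = \<kappa> * (- \<i> * of_real pi * (v \<theta> * M z \<theta>))"
    using tendsto_unique[OF trivial_limit_at_right_real _ jump] by blast
  \<comment> \<open>On the diagonal the denominator equals \<open>(q;q)_inf^2\<close> times the
    theta product of the weight, and the prefactors cancel too; only elementary factors
    survive.\<close>
  also have "v \<theta> * M z \<theta> = 2 * c * of_real (sin \<theta>) * f x / of_real pi"
  proof -
    have qz: "norm (of_real q :: complex) < 1" using q by simp
    have z2: "qth q (of_real q) (z\<^sup>2) \<noteq> 0"
      using nz by (intro qth_nonzero_circle[OF q qz]) (simp add: norm_power)
    have "K_denom q q z \<theta> = P * P * qth q (of_real q) (z\<^sup>2)"
      using nz by (simp add: K_denom_def qth_def P_def z_def[symmetric] power2_eq_square mult_ac)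
    then show ?thesis
      unfolding M_def v_def using hc[of \<theta>] P0 z2 by (simp add: \<theta>(3) z_def[symmetric] field_simps)
  qed
  also have "\<kappa> * (- \<i> * of_real pi * (2 * c * of_real (sin \<theta>) * f x / of_real pi))
      = (1 / z - z) * (\<kappa> * (c * f x))"
  proof -
    have "1 / z - z = - (2 * \<i> * of_real (sin \<theta>))"
      using cis_arccos_minus_inverse(1)[OF x] unfolding z_def \<theta>_def by (metis minus_diff_eq)
    then show ?thesis by simp
  qed
  finally have "aw_op q h x = of_real (2 * sqrt q / (1 - q)) * (\<kappa> * (c * f x))"
    by (rule aw_op_value[OF x z_def[unfolded \<theta>_def]])
  then show ?thesis by (simp add: mult_ac)
qed

end

section \<open>Matching of constants and iteration of the \<open>q\<close>-difference\<close>

definition K_const :: "real \<Rightarrow> complex \<Rightarrow> nat \<Rightarrow> complex" where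
  "K_const q c n = of_real (q powr (real n * (real n - 3) / 4)) * (of_real (1 - q) / (2 * c)) ^ n"

context
  fixes q :: real
  assumes q: "0 < q" "q < 1"
begin

text \<open>With \<open>Z = (1 - q) / (2 c)\<close>, the second operator raises \<open>t Z\<close>
  to the power \<open>b\<close>. As \<open>t > 0\<close>, the principal power splits off
  \<open>t powr b\<close>, and \<open>Z powr a * Z powr b\<close> becomes the ordinary power
  \<open>Z ^ n\<close>, so no branch ambiguity is left.\<close>

lemma K_op_compose:
  fixes a b :: real
  assumes a: "0 < a" and b: "0 < b" and n: "a + b = real n"
    and adm: "admissible q c" "admissible q (c * of_real (q powr (- a / 2)))"
    and f: "continuous_on {-1..1} f"
  shows "K_op q b (c * of_real (q powr (- a / 2))) (K_op q a c f) x
    = K_const q c n * K_ext q c f (q powr (real n / 2)) (cis (arccos x))"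
proof -
  define t s Z where "t = q powr (a / 2)" and "s = q powr (b / 2)" and "Z = complex_of_real (1 - q) / (2 * c)"
  have ts: "0 < t" "t < 1" "0 < s" "s < 1" using q a b by (simp_all add: t_def s_def powr01_less_one)
  have c': "c * of_real (q powr (- a / 2)) = c / of_real t"
  proof -
    have "q powr (- a / 2) = inverse t" unfolding t_def powr_minus[symmetric] by simp
    then show ?thesis by (simp only: of_real_inverse divide_inverse)
  qed
  have c0: "c \<noteq> 0" using adm by (auto simp: admissible_def)
  have "complex_of_real (1 - q) \<noteq> 0" using q by (subst of_real_eq_0_iff) simp
  then have Z0: "Z \<noteq> 0" using c0 by (simp only: Z_def divide_eq_0_iff mult_eq_0_iff) simp
  define Ca where "Ca = of_real (q powr (a * (a - 3) / 4)) * Z powr of_real a"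
  have Ka: "K_op q a c f = (\<lambda>x. Ca * K_ext q c f t (cis (arccos x)))"
    by (rule ext) (simp only: K_op_eq_K_ext[OF q] Ca_def Z_def t_def)
  have st: "s * t = q powr (real n / 2)"
    unfolding s_def t_def n[symmetric] powr_add[symmetric] by (simp add: add_divide_distrib add.commute)
  have K: "K_ext q (c / of_real t) (K_op q a c f) s (cis (arccos x)) = Ca * K_ext q c f (q powr (real n / 2)) (cis (arccos x))"
    unfolding Ka K_ext_cmult st[symmetric]
    by (subst K_ext_semigroup[OF q adm(1) adm(2)[unfolded c'] f ts(3,4,1,2)]) simp_all
  have "of_real (1 - q) / (2 * (c / of_real t)) = of_real t * Z"
    by (simp add: Z_def)
  moreover have "(of_real t * Z) powr of_real b = of_real (t powr b) * Z powr of_real b"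
    using powr_times_real_left[of "of_real t" Z "of_real b"] powr_of_real[of t b] ts(1) by simp
  ultimately have pb: "(of_real (1 - q) / (2 * (c / of_real t))) powr of_real b = of_real (t powr b) * Z powr of_real b"
    by simp
  have qp: "q powr (b * (b - 3) / 4) * t powr b * q powr (a * (a - 3) / 4) = q powr (real n * (real n - 3) / 4)"
  proof -
    have "q powr (b * (b - 3) / 4) * t powr b * q powr (a * (a - 3) / 4)
        = q powr (b * (b - 3) / 4 + a / 2 * b + a * (a - 3) / 4)"
      unfolding t_def powr_powr powr_add ..
    also have "b * (b - 3) / 4 + a / 2 * b + a * (a - 3) / 4 = (a + b) * ((a + b) - 3) / 4"
      by (simp add: field_simps)
    finally show ?thesis unfolding n .
  qed
  have Zp: "Z powr of_real a * Z powr of_real b = Z ^ n"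
  proof -
    have "Z powr of_real a * Z powr of_real b = Z powr of_real (a + b)"
      by (simp add: powr_add)
    also have "\<dots> = Z ^ n" unfolding n using Z0 by (simp add: powr_nat')
    finally show ?thesis .
  qed
  have "K_op q b (c / of_real t) (K_op q a c f) x
      = of_real (q powr (b * (b - 3) / 4)) * (of_real (t powr b) * Z powr of_real b)
        * (Ca * K_ext q c f (q powr (real n / 2)) (cis (arccos x)))"
    unfolding K_op_eq_K_ext[OF q, of b] pb s_def[symmetric] K ..
  also have "\<dots> = of_real (q powr (b * (b - 3) / 4) * t powr b * q powr (a * (a - 3) / 4)) * (Z powr of_real a * Z powr of_real b)
        * K_ext q c f (q powr (real n / 2)) (cis (arccos x))"
    unfolding Ca_def of_real_mult by (simp only: mult_ac)
  finally show ?thesis unfolding c' qp Zp unfolding K_const_def Z_def .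
qed

text \<open>Absorbs the factor produced by \<open>aw_op_K_ext\<close> at
  \<open>t = q powr ((n + 1) / 2)\<close>, where \<open>t / \<surd>q = q powr (n / 2)\<close>: the
  exponents satisfy \<open>(n + 1)(n - 2) / 4 + 1/2 - n/2 = n (n - 3) / 4\<close>.\<close>

lemma K_const_step:
  assumes "c \<noteq> 0"
  shows "K_const q c (Suc n) * (2 * c * of_real (sqrt q / (1 - q))) / of_real (q powr (real n / 2)) = K_const q c n"
proof -
  have e: "q powr (real (Suc n) * (real (Suc n) - 3) / 4) * sqrt q / q powr (real n / 2) = q powr (real n * (real n - 3) / 4)"
  proof -
    have "q powr (real (Suc n) * (real (Suc n) - 3) / 4) * sqrt q / q powr (real n / 2)
        = q powr (real (Suc n) * (real (Suc n) - 3) / 4 + 1 / 2 - real n / 2)"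
      using q by (simp add: powr_add powr_diff powr_half_sqrt)
    also have "real (Suc n) * (real (Suc n) - 3) / 4 + 1 / 2 - real n / 2 = real n * (real n - 3) / 4"
      by (simp add: field_simps)
    finally show ?thesis .
  qed
  have q1: "complex_of_real (1 - q) \<noteq> 0" using q by (subst of_real_eq_0_iff) simp
  have "K_const q c (Suc n) * (2 * c * of_real (sqrt q / (1 - q))) / of_real (q powr (real n / 2))
      = of_real (q powr (real (Suc n) * (real (Suc n) - 3) / 4) * sqrt q / q powr (real n / 2))
        * ((of_real (1 - q) / (2 * c)) ^ Suc n * (2 * c / of_real (1 - q)))"
    by (simp add: K_const_def)
  also have "(of_real (1 - q) / (2 * c)) ^ Suc n * (2 * c / of_real (1 - q)) = (of_real (1 - q) / (2 * c)) ^ n"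
    using assms q1 by (simp del: of_real_diff)
  finally show ?thesis unfolding e K_const_def .
qed

text \<open>The induction peels off the first application of \<open>aw_op\<close>, whose result is
  known only on the open interval; hence \<open>g\<close> is arbitrary and described only there. The
  base case is the critical parameter \<open>\<surd>q\<close>.\<close>

lemma aw_op_iterate_K_ext:
  assumes adm: "admissible q c" and f: "continuous_on {-1..1} f"
    and g: "\<And>x. x \<in> {-1<..<1} \<Longrightarrow> g x = K_const q c (Suc n) * K_ext q c f (q powr (real (Suc n) / 2)) (cis (arccos x))"
    and dom: "\<And>k. k \<le> n \<Longrightarrow> (aw_op q ^^ k) g \<in> aw_dom q"
    and x: "x \<in> {-1<..<1}"
  shows "(aw_op q ^^ Suc n) g x = f x"
  using g dom
proof (induction n arbitrary: g)
  case 0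
  have c0: "c \<noteq> 0" using adm by (auto simp: admissible_def)
  have "aw_op q g x = K_const q c (Suc 0) * (2 * c * of_real (sqrt q / (1 - q))) * f x"
    using 0(1) 0(2)[of 0] q by (intro aw_op_K_ext_critical[OF q _ adm f _ x]) (simp_all add: powr_half_sqrt)
  moreover have "K_const q c (Suc 0) * (2 * c * of_real (sqrt q / (1 - q))) = 1"
    using K_const_step[OF c0, of 0] q by (simp add: K_const_def[of _ _ 0] del: of_real_divide)
  ultimately show ?case by (simp only: mult_1_left funpow.simps comp_apply id_apply)
next
  case (Suc n)
  have c0: "c \<noteq> 0" using adm by (auto simp: admissible_def)
  define t where "t = q powr (real (Suc (Suc n)) / 2)"
  have t: "t / sqrt q = q powr (real (Suc n) / 2)"
  proof -
    have "t = q powr (real (Suc n) / 2 + 1 / 2)"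
      unfolding t_def by (simp add: add_divide_distrib)
    then show ?thesis using q by (simp add: powr_add powr_half_sqrt)
  qed
  have t1: "0 < t" "t < sqrt q"
  proof -
    show "0 < t" using q by (simp add: t_def)
    have "t / sqrt q < 1" unfolding t using q by (simp add: powr01_less_one)
    then show "t < sqrt q" using q by simp
  qed
  have "aw_op q g y = K_const q c (Suc n) * K_ext q c f (q powr (real (Suc n) / 2)) (cis (arccos y))"
    if "y \<in> {-1<..<1}" for y
    using aw_op_K_ext[OF q _ adm f t1 _ that, of g "K_const q c (Suc (Suc n))"] Suc.prems(1) Suc.prems(2)[of 0]
    unfolding t K_const_step[OF c0] by (simp add: t_def)
  moreover have "(aw_op q ^^ k) (aw_op q g) \<in> aw_dom q" if "k \<le> n" for k
    using Suc.prems(2)[of "Suc k"] that by (simp add: funpow_swap1)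
  ultimately have "(aw_op q ^^ Suc n) (aw_op q g) x = f x"
    by (rule Suc.IH)
  then show ?case by (simp add: funpow_swap1)
qed

end

theorem theorem3p2:
  fixes q a :: real and c :: complex and f :: "real \<Rightarrow> complex"
  defines "g \<equiv> K_op q (1 - frac a) (c * of_real (q powr (- a / 2))) (K_op q a c f)"
  assumes "0 < q" and "q < 1" and "0 < a"
    and "admissible q c" and "admissible q (c * of_real (q powr (- a / 2)))"
    and "continuous_on {-1..1} f"
    and "\<forall>k < nat \<lfloor>a\<rfloor> + 1. (aw_op q ^^ k) g \<in> aw_dom q"
  shows "\<forall>x\<in>{-1<..<1}. (aw_op q ^^ (nat \<lfloor>a\<rfloor> + 1)) g x = f x"
proof
  fix x :: real assume x: "x \<in> {-1<..<1}"
  define n where "n = nat \<lfloor>a\<rfloor>"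
  have n: "a + (1 - frac a) = real (Suc n)" "0 < 1 - frac a"
    using \<open>0 < a\<close> frac_lt_1[of a] by (simp_all add: n_def frac_def)
  have "(aw_op q ^^ Suc n) g x = f x"
  proof (rule aw_op_iterate_K_ext[OF assms(2,3,5,7) _ _ x])
    show "g y = K_const q c (Suc n) * K_ext q c f (q powr (real (Suc n) / 2)) (cis (arccos y))" for y
      unfolding g_def by (rule K_op_compose[OF assms(2,3,4) n(2,1) assms(5,6,7)])
    show "(aw_op q ^^ k) g \<in> aw_dom q" if "k \<le> n" for k
      using assms(8) that by (simp add: n_def)
  qed
  then show "(aw_op q ^^ (nat \<lfloor>a\<rfloor> + 1)) g x = f x"
    by (simp add: n_def)
qed

end
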